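(* Let $k$ be a field of characteristic zero and $2\le N<6$. The first noncommutative de Rham cohomology of $S_N$ with the 2-cycle differential structure is $H^1(S_N)=k\cdot\theta$, i.e. it is one-dimensional, spanned by the class of $\theta=\sum_{a\in\mathcal{C}}e_a$, where $\mathcal{C}$ is the set of 2-cycles in $S_N$.
   Context: Let $G=S_N$ and $\mathcal{C}\subset G$ the conjugacy class of 2-cycles. Let $k(G)$ be the algebra of functions $G\to k$, with $R_a(f)(g)=f(ga)$. Let $\Lambda^1=k\mathcal{C}$ with basis $\{e_a\}_{a\in\mathcal{C}}$ and $\Psi(e_a\otimes e_b)=e_{aba^{-1}}\otimes e_a$, and let $\Lambda_{quad}=T\Lambda^1/\langle\ker(\mathrm{id}-\Psi)\rangle$. The exterior algebra $\Omega=\Omega_{quad}(G)=\bigoplus_n\Omega^n$ is the graded algebra generated by $k(G)$ (in degree 0) and $\Lambda_{quad}$ (so $e_a$ has degree 1), with cross relations $e_af=R_a(f)e_a$; it is a free left $k(G)$-module $\Omega=k(G)\otimes\Lambda_{quad}$. The differential is the graded commutator with $\theta=\sum_{a\in\mathcal{C}}e_a$: $\mathrm{d}\omega=\theta\omega-(-1)^{n}\omega\theta$ for $\omega\in\Omega^n$; in particular $\mathrm{d}f=\sum_a(R_a(f)-f)e_a$ and $\mathrm{d}e_a=\theta e_a+e_a\theta$. The noncommutative de Rham cohomology is $H^n=\ker(\mathrm{d}|_{\Omega^n})/\mathrm{d}(\Omega^{n-1})$. *)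

theory Defs
  imports "HOL-Algebra.Sym_Groups" "HOL-Algebra.QuotRing" "Jordan_Normal_Form.VS_Connect"
begin

section \<open>The algebra generated by k(G) and the tensor algebra on C\<close>

text \<open>
  Let \<open>G\<close> be a group, \<open>C\<close> a finite subset of \<open>G\<close> stable under conjugation and \<open>'k\<close> a field.
  The tensor algebra of \<open>\<Lambda>\<^sup>1 = k C\<close> has the words \<open>w\<close> over \<open>C\<close> as a basis; the word
  \<open>[a, b]\<close> stands for \<open>e_a \<otimes> e_b\<close>. An element \<open>x\<close> of k(G) \<open>\<otimes>\<close> T\<open>\<Lambda>\<^sup>1\<close> is represented by its
  coefficients: \<open>x g w\<close> is the value at \<open>g\<close> of the coefficient function of the basis word \<open>w\<close>,
  extended by \<open>0\<close> outside \<open>G\<close>.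
\<close>

definition word_prod :: "('g, 'm) monoid_scheme \<Rightarrow> 'g list \<Rightarrow> 'g" where
  "word_prod G w = foldr (\<lambda>a b. a \<otimes>\<^bsub>G\<^esub> b) w \<one>\<^bsub>G\<^esub>"

definition tens ::
  "('g, 'm) monoid_scheme \<Rightarrow> ('g \<Rightarrow> 'k) \<Rightarrow> ('g list \<Rightarrow> 'k) \<Rightarrow> 'g \<Rightarrow> 'g list \<Rightarrow> 'k::field" where
  "tens G f t = (\<lambda>g w. if g \<in> carrier G then f g * t w else 0)"

definition word_basis :: "'g list \<Rightarrow> 'g list \<Rightarrow> 'k::field" where
  "word_basis w = (\<lambda>v. if v = w then 1 else 0)"

text \<open>
  The cross relations \<open>e_a f = R_a(f) e_a\<close> with \<open>R_a(f)(g) = f(ga)\<close> force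
  \<open>(f e_u) (h e_v) = f R_p(h) e_(u @ v)\<close> for words \<open>u\<close> and \<open>v\<close>, where \<open>p\<close> is the product of the
  letters of \<open>u\<close>. The multiplication below is the bilinear extension of this formula: the word
  \<open>w\<close> is split in all ways as \<open>u @ v\<close>.
\<close>

definition cross_alg ::
  "('g, 'm) monoid_scheme \<Rightarrow> 'g set \<Rightarrow> ('g \<Rightarrow> 'g list \<Rightarrow> 'k::field) ring" where
  "cross_alg G C =
    \<lparr>carrier = {x. finite {w. \<exists>g. x g w \<noteq> 0} \<and>
                   (\<forall>g w. x g w \<noteq> 0 \<longrightarrow> g \<in> carrier G \<and> w \<in> lists C)},
     mult = (\<lambda>x y g w. \<Sum>i\<le>length w.
               x g (take i w) * y (g \<otimes>\<^bsub>G\<^esub> word_prod G (take i w)) (drop i w)),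
     one = tens G (\<lambda>_. 1) (word_basis []),
     zero = (\<lambda>g w. 0),
     add = (\<lambda>x y g w. x g w + y g w)\<rparr>"

lemma word_prod_closed:
  assumes "group G" "C \<subseteq> carrier G" "w \<in> lists C"
  shows "word_prod G w \<in> carrier G"
proof -
  interpret group G by fact
  show ?thesis using assms(3,2) by (induction w) (auto simp: word_prod_def)
qed

lemma word_prod_append:
  assumes "group G" "C \<subseteq> carrier G" "u \<in> lists C" "v \<in> lists C"
  shows "word_prod G (u @ v) = word_prod G u \<otimes>\<^bsub>G\<^esub> word_prod G v"
proof -
  interpret group G by fact
  have "word_prod G v \<in> carrier G" using word_prod_closed assms by blast
  with assms(3,2) show ?thesis
  proof (induction u)
    case Nil then show ?case by (simp add: word_prod_def)
  next
    case (Cons a u)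
    have "word_prod G u \<in> carrier G" using word_prod_closed Cons assms by blast
    with Cons show ?case by (auto simp: word_prod_def m_assoc)
  qed
qed

lemma cross_alg_carrierD:
  assumes "x \<in> carrier (cross_alg G C)" "x g w \<noteq> 0"
  shows "g \<in> carrier G" "w \<in> lists C"
  using assms by (auto simp: cross_alg_def)

lemma cross_alg_mult_closed:
  fixes x y :: "'g \<Rightarrow> 'g list \<Rightarrow> 'k::field"
  assumes "group G" "C \<subseteq> carrier G" "x \<in> carrier (cross_alg G C)" "y \<in> carrier (cross_alg G C)"
  shows "x \<otimes>\<^bsub>cross_alg G C\<^esub> y \<in> carrier (cross_alg G C)"
proof -
  let ?z = "x \<otimes>\<^bsub>cross_alg G C\<^esub> y"
  have *: "g \<in> carrier G \<and> w \<in> (\<lambda>(u,v). u @ v) ` ({w. \<exists>g. x g w \<noteq> 0} \<times> {w. \<exists>g. y g w \<noteq> 0})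
      \<and> w \<in> lists C" if nz: "?z g w \<noteq> 0" for g w
  proof -
    obtain i where i: "x g (take i w) \<noteq> 0" "y (g \<otimes>\<^bsub>G\<^esub> word_prod G (take i w)) (drop i w) \<noteq> 0"
      using sum.not_neutral_contains_not_neutral[OF nz[unfolded cross_alg_def, simplified]] by auto
    have "take i w \<in> lists C" "drop i w \<in> lists C" "g \<in> carrier G"
      using cross_alg_carrierD[OF assms(3) i(1)] cross_alg_carrierD[OF assms(4) i(2)] by auto
    then have "w \<in> lists C" by (metis append_in_lists_conv append_take_drop_id)
    moreover have "w \<in> (\<lambda>(u,v). u @ v) ` ({w. \<exists>g. x g w \<noteq> 0} \<times> {w. \<exists>g. y g w \<noteq> 0})"
      by (rule image_eqI[of _ _ "(take i w, drop i w)"]) (use i in auto)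
    ultimately show ?thesis using \<open>g \<in> carrier G\<close> by blast
  qed
  have "finite ({w. \<exists>g. x g w \<noteq> 0} \<times> {w. \<exists>g. y g w \<noteq> 0})"
    using assms(3,4) by (simp add: cross_alg_def)
  then have "finite {w. \<exists>g. ?z g w \<noteq> 0}"
    by (rule finite_subset[rotated, OF finite_imageI[of _ "\<lambda>(u,v). u @ v"]]) (use * in blast)
  with * show ?thesis unfolding cross_alg_def by auto
qed

lemma cross_alg_assoc:
  fixes x y z :: "'g \<Rightarrow> 'g list \<Rightarrow> 'k::field"
  assumes "group G" "C \<subseteq> carrier G" "x \<in> carrier (cross_alg G C)" "y \<in> carrier (cross_alg G C)"
  shows "(x \<otimes>\<^bsub>cross_alg G C\<^esub> y) \<otimes>\<^bsub>cross_alg G C\<^esub> z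
       = x \<otimes>\<^bsub>cross_alg G C\<^esub> (y \<otimes>\<^bsub>cross_alg G C\<^esub> z)"
proof (intro ext)
  interpret group G by fact
  fix g w
  let ?p = "word_prod G"
  let ?t = "\<lambda>i j. x g (take i w) * y (g \<otimes>\<^bsub>G\<^esub> ?p (take i w)) (take (j - i) (drop i w))
       * z (g \<otimes>\<^bsub>G\<^esub> ?p (take j w)) (drop j w)"
  have t: "x g (take i w) * y (g \<otimes>\<^bsub>G\<^esub> ?p (take i w)) (take j (drop i w))
       * z (g \<otimes>\<^bsub>G\<^esub> ?p (take i w) \<otimes>\<^bsub>G\<^esub> ?p (take j (drop i w))) (drop j (drop i w)) = ?t i (i + j)" for i j
  proof (cases "x g (take i w) = 0 \<or> y (g \<otimes>\<^bsub>G\<^esub> ?p (take i w)) (take j (drop i w)) = 0")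
    case False
    then have a: "take i w \<in> lists C" "take j (drop i w) \<in> lists C" "g \<in> carrier G"
      using False cross_alg_carrierD[OF assms(3), of g "take i w"]
        cross_alg_carrierD[OF assms(4), of _ "take j (drop i w)"] by auto
    have "?p (take (i + j) w) = ?p (take i w) \<otimes>\<^bsub>G\<^esub> ?p (take j (drop i w))"
      using word_prod_append[OF assms(1,2) a(1,2)] by (simp add: take_add)
    moreover have "?p (take i w) \<in> carrier G" "?p (take j (drop i w)) \<in> carrier G"
      using word_prod_closed[OF assms(1,2)] a by auto
    ultimately show ?thesis using a(3) by (simp add: m_assoc add.commute)
  qed auto
  have "((x \<otimes>\<^bsub>cross_alg G C\<^esub> y) \<otimes>\<^bsub>cross_alg G C\<^esub> z) g w = (\<Sum>j\<le>length w. \<Sum>i\<le>j. ?t i j)"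
    by (auto simp: cross_alg_def sum_distrib_right min_def drop_take intro!: sum.cong)
  also have "\<dots> = (\<Sum>i\<le>length w. \<Sum>j=i..length w. ?t i j)"
    using sum.nested_swap'[of "\<lambda>j i. ?t i j" "length w"]
    by (subst sum.Sigma, simp, simp, subst sum.Sigma, simp, simp)
       (rule sum.reindex_bij_witness[where i="\<lambda>(i,j). (j,i)" and j="\<lambda>(i,j). (j,i)"]; auto)
  also have "\<dots> = (\<Sum>i\<le>length w. \<Sum>j\<le>length w - i. ?t i (i + j))"
  proof (rule sum.cong[OF refl])
    fix i assume "i \<in> {..length w}"
    then show "(\<Sum>j=i..length w. ?t i j) = (\<Sum>j\<le>length w - i. ?t i (i + j))"
      by (intro sum.reindex_bij_witness[where i="\<lambda>j. i + j" and j="\<lambda>j. j - i"]) auto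
  qed
  also have "\<dots> = (x \<otimes>\<^bsub>cross_alg G C\<^esub> (y \<otimes>\<^bsub>cross_alg G C\<^esub> z)) g w"
    unfolding t[symmetric] by (simp add: cross_alg_def sum_distrib_left mult.assoc)
  finally show "((x \<otimes>\<^bsub>cross_alg G C\<^esub> y) \<otimes>\<^bsub>cross_alg G C\<^esub> z) g w
       = (x \<otimes>\<^bsub>cross_alg G C\<^esub> (y \<otimes>\<^bsub>cross_alg G C\<^esub> z)) g w" .
qed

lemma ring_cross_alg:
  assumes "group G" "C \<subseteq> carrier G"
  shows "ring (cross_alg G C :: ('g \<Rightarrow> 'g list \<Rightarrow> 'k::field) ring)" (is "ring ?A")
proof (rule ringI)
  interpret group G by fact
  show "abelian_group ?A"
  proof (rule abelian_groupI)
    fix x y assume xy: "x \<in> carrier ?A" "y \<in> carrier ?A"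
    have "{w. \<exists>g. x g w + y g w \<noteq> 0} \<subseteq> {w. \<exists>g. x g w \<noteq> 0} \<union> {w. \<exists>g. y g w \<noteq> 0}" by auto
    then have "finite {w. \<exists>g. x g w + y g w \<noteq> 0}"
      by (rule finite_subset) (use xy in \<open>simp add: cross_alg_def\<close>)
    with xy show "x \<oplus>\<^bsub>?A\<^esub> y \<in> carrier ?A" by (auto simp: cross_alg_def)
         (metis add.right_neutral lists_eq_set mem_Collect_eq subsetD)+
  next
    fix x assume "x \<in> carrier ?A"
    then show "\<exists>y\<in>carrier ?A. y \<oplus>\<^bsub>?A\<^esub> x = \<zero>\<^bsub>?A\<^esub>"
      by (intro bexI[of _ "\<lambda>g w. - x g w"]) (auto simp: cross_alg_def)
  qed (auto simp: cross_alg_def algebra_simps)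
  show "monoid ?A"
  proof (rule monoidI)
    have "{w. \<exists>g. tens G (\<lambda>_. 1) (word_basis []) g w \<noteq> (0::'k)} \<subseteq> {[]}"
      by (auto simp: tens_def word_basis_def split: if_splits)
    then have "finite {w. \<exists>g. tens G (\<lambda>_. 1) (word_basis []) g w \<noteq> (0::'k)}"
      by (rule finite_subset) simp
    then show "\<one>\<^bsub>?A\<^esub> \<in> carrier ?A"
      by (auto simp: cross_alg_def tens_def word_basis_def split: if_splits)
  next
    fix x assume x: "x \<in> carrier ?A"
    have x0: "x g w = 0" if "g \<notin> carrier G" for g w using x that by (auto simp: cross_alg_def)
    show "\<one>\<^bsub>?A\<^esub> \<otimes>\<^bsub>?A\<^esub> x = x"
    proof (intro ext)
      fix g w
      have "(\<one>\<^bsub>?A\<^esub> \<otimes>\<^bsub>?A\<^esub> x) g w = (\<Sum>i\<le>length w. if i = 0 then x g w else 0)"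
        unfolding cross_alg_def monoid.simps ring.simps
        by (rule sum.cong) (auto simp: tens_def word_basis_def word_prod_def x0)
      then show "(\<one>\<^bsub>?A\<^esub> \<otimes>\<^bsub>?A\<^esub> x) g w = x g w" by simp
    qed
    show "x \<otimes>\<^bsub>?A\<^esub> \<one>\<^bsub>?A\<^esub> = x"
    proof (intro ext)
      fix g w
      have "(x \<otimes>\<^bsub>?A\<^esub> \<one>\<^bsub>?A\<^esub>) g w = (\<Sum>i\<le>length w. if i = length w then x g w else 0)"
      proof -
        have x_or: "x g (take i w) = 0 \<or> g \<otimes>\<^bsub>G\<^esub> word_prod G (take i w) \<in> carrier G" for i
          using cross_alg_carrierD[OF x, of g "take i w"] word_prod_closed[OF assms, of "take i w"] by auto
        then show ?thesis
          unfolding cross_alg_def monoid.simps ring.simps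
          by (intro sum.cong refl) (use x_or[of "length w"] in \<open>auto simp: tens_def word_basis_def\<close>)
      qed
      then show "(x \<otimes>\<^bsub>?A\<^esub> \<one>\<^bsub>?A\<^esub>) g w = x g w" by simp
    qed
  qed (use cross_alg_mult_closed[OF assms] cross_alg_assoc[OF assms] in auto)
qed (auto simp: cross_alg_def sum.distrib algebra_simps intro!: ext)

lemma cross_relation:
  assumes "group G" "a \<in> carrier G"
  shows "tens G (\<lambda>_. 1) (word_basis [a]) \<otimes>\<^bsub>cross_alg G C\<^esub> tens G f (word_basis [])
    = tens G (\<lambda>g. f (g \<otimes>\<^bsub>G\<^esub> a)) (word_basis [])
      \<otimes>\<^bsub>cross_alg G C\<^esub> tens G (\<lambda>_. 1) (word_basis [a :: 'g])" (is "?l = (?r :: _ \<Rightarrow> _ \<Rightarrow> 'k::field)")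
proof (intro ext)
  interpret group G by fact
  fix g w
  have "?l g w = (\<Sum>i\<le>length w. if i = 1 \<and> w = [a] \<and> g \<in> carrier G then f (g \<otimes>\<^bsub>G\<^esub> a) else 0)"
    unfolding cross_alg_def monoid.simps ring.simps
  proof (intro sum.cong refl)
    fix i
    have "take i w = [a] \<and> drop i w = [] \<longleftrightarrow> w = [a] \<and> i \<ge> 1"
      by (metis One_nat_def append_Nil2 append_take_drop_id drop_eq_Nil length_Cons list.size(3) take_all_iff)
    moreover assume "i \<in> {..length w}"
    ultimately have *: "take i w = [a] \<and> drop i w = [] \<longleftrightarrow> i = 1 \<and> w = [a]" by auto
    show "tens G (\<lambda>_. 1) (word_basis [a]) g (take i w) *
      tens G f (word_basis []) (g \<otimes>\<^bsub>G\<^esub> word_prod G (take i w)) (drop i w) =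
      (if i = 1 \<and> w = [a] \<and> g \<in> carrier G then f (g \<otimes>\<^bsub>G\<^esub> a) else 0)"
      using * assms(2) by (auto simp: tens_def word_basis_def word_prod_def)
  qed
  moreover have "?r g w = (\<Sum>i\<le>length w. if i = 0 \<and> w = [a] \<and> g \<in> carrier G then f (g \<otimes>\<^bsub>G\<^esub> a) else 0)"
    unfolding cross_alg_def monoid.simps ring.simps
    by (intro sum.cong refl) (use assms(2) in \<open>auto simp: tens_def word_basis_def word_prod_def\<close>)
  ultimately show "?l g w = ?r g w" by (cases "w = [a] \<and> g \<in> carrier G") auto
qed

section \<open>The exterior algebra\<close>

text \<open>
  \<open>braiding\<close> is the linear extension to \<open>\<Lambda>\<^sup>1 \<otimes> \<Lambda>\<^sup>1\<close> of
  \<open>e_a \<otimes> e_b \<mapsto> e_(a b inv a) \<otimes> e_a\<close>.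
\<close>

definition braiding ::
  "('g, 'm) monoid_scheme \<Rightarrow> 'g set \<Rightarrow> ('g list \<Rightarrow> 'k) \<Rightarrow> 'g list \<Rightarrow> 'k::field" where
  "braiding G C t =
    (\<lambda>w. \<Sum>a\<in>C. \<Sum>b\<in>C. t [a, b] * word_basis [a \<otimes>\<^bsub>G\<^esub> b \<otimes>\<^bsub>G\<^esub> inv\<^bsub>G\<^esub> a, a] w)"

definition ker_id_minus_braiding ::
  "('g, 'm) monoid_scheme \<Rightarrow> 'g set \<Rightarrow> ('g list \<Rightarrow> 'k::field) set" where
  "ker_id_minus_braiding G C =
    {t. (\<forall>w. t w \<noteq> 0 \<longrightarrow> w \<in> lists C \<and> length w = 2) \<and> (\<forall>w. t w - braiding G C t w = 0)}"

definition quad_ideal ::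
  "('g, 'm) monoid_scheme \<Rightarrow> 'g set \<Rightarrow> ('g \<Rightarrow> 'g list \<Rightarrow> 'k::field) set" where
  "quad_ideal G C = Idl\<^bsub>cross_alg G C\<^esub> (tens G (\<lambda>_. 1) ` ker_id_minus_braiding G C)"

definition Omega ::
  "('g, 'm) monoid_scheme \<Rightarrow> 'g set \<Rightarrow> ('g \<Rightarrow> 'g list \<Rightarrow> 'k::field) set ring" where
  "Omega G C = cross_alg G C Quot quad_ideal G C"

definition Omega_class ::
  "('g, 'm) monoid_scheme \<Rightarrow> 'g set \<Rightarrow> ('g \<Rightarrow> 'g list \<Rightarrow> 'k) \<Rightarrow> ('g \<Rightarrow> 'g list \<Rightarrow> 'k::field) set" where
  "Omega_class G C x = quad_ideal G C +>\<^bsub>cross_alg G C\<^esub> x"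

text \<open>The field \<open>'k\<close> acts through the constant functions in k(G).\<close>

definition Omega_module ::
  "('g, 'm) monoid_scheme \<Rightarrow> 'g set \<Rightarrow> ('k::field, ('g \<Rightarrow> 'g list \<Rightarrow> 'k) set) module" where
  "Omega_module G C = ring.extend (Omega G C)
    \<lparr>smult = (\<lambda>c \<omega>. Omega_class G C (tens G (\<lambda>_. c) (word_basis [])) \<otimes>\<^bsub>Omega G C\<^esub> \<omega>)\<rparr>"

definition Omega_deg ::
  "('g, 'm) monoid_scheme \<Rightarrow> 'g set \<Rightarrow> nat \<Rightarrow> ('g \<Rightarrow> 'g list \<Rightarrow> 'k::field) set set" where
  "Omega_deg G C n = Omega_class G C `
    {x \<in> carrier (cross_alg G C). \<forall>g w. x g w \<noteq> 0 \<longrightarrow> length w = n}"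

definition theta ::
  "('g, 'm) monoid_scheme \<Rightarrow> 'g set \<Rightarrow> ('g \<Rightarrow> 'g list \<Rightarrow> 'k::field) set" where
  "theta G C = (\<Oplus>\<^bsub>Omega G C\<^esub>a\<in>C. Omega_class G C (tens G (\<lambda>_. 1) (word_basis [a])))"

definition ext_d ::
  "('g, 'm) monoid_scheme \<Rightarrow> 'g set \<Rightarrow> nat \<Rightarrow>
    ('g \<Rightarrow> 'g list \<Rightarrow> 'k) set \<Rightarrow> ('g \<Rightarrow> 'g list \<Rightarrow> 'k::field) set" where
  "ext_d G C n \<omega> =
    theta G C \<otimes>\<^bsub>Omega G C\<^esub> \<omega> \<ominus>\<^bsub>Omega G C\<^esub>
    ((\<ominus>\<^bsub>Omega G C\<^esub> \<one>\<^bsub>Omega G C\<^esub>) [^]\<^bsub>Omega G C\<^esub> n) \<otimes>\<^bsub>Omega G C\<^esub> (\<omega> \<otimes>\<^bsub>Omega G C\<^esub> theta G C)"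

section \<open>Noncommutative de Rham cohomology\<close>

definition cocycles ::
  "('g, 'm) monoid_scheme \<Rightarrow> 'g set \<Rightarrow> nat \<Rightarrow> ('g \<Rightarrow> 'g list \<Rightarrow> 'k::field) set set" where
  "cocycles G C n = {\<omega> \<in> Omega_deg G C n. ext_d G C n \<omega> = \<zero>\<^bsub>Omega G C\<^esub>}"

definition coboundaries ::
  "('g, 'm) monoid_scheme \<Rightarrow> 'g set \<Rightarrow> nat \<Rightarrow> ('g \<Rightarrow> 'g list \<Rightarrow> 'k::field) set set" where
  "coboundaries G C n =
    (case n of 0 \<Rightarrow> {\<zero>\<^bsub>Omega G C\<^esub>} | Suc m \<Rightarrow> ext_d G C m ` Omega_deg G C m)"

text \<open>
  The ring multiplication and unit of a \<open>module\<close> record play no role for modules and are left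
  undefined. As in \<^const>\<open>rcoset_mult\<close>, the scalar multiple of a coset is formed from all its
  representatives.
\<close>

definition quot_module :: "('k, 'v, 'm) module_scheme \<Rightarrow> 'v set \<Rightarrow> ('k, 'v set) module" where
  "quot_module M B =
    \<lparr>carrier = a_rcosets\<^bsub>M\<^esub> B, mult = undefined, one = undefined,
     zero = B, add = set_add M,
     smult = (\<lambda>c X. \<Union>x\<in>X. B +>\<^bsub>M\<^esub> (c \<odot>\<^bsub>M\<^esub> x))\<rparr>"

definition deRham_H ::
  "('g, 'm) monoid_scheme \<Rightarrow> 'g set \<Rightarrow> nat \<Rightarrow> ('k::field, ('g \<Rightarrow> 'g list \<Rightarrow> 'k) set set) module" where
  "deRham_H G C n =
    quot_module (Omega_module G C\<lparr>carrier := cocycles G C n\<rparr>) (coboundaries G C n)"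

definition deRham_class ::
  "('g, 'm) monoid_scheme \<Rightarrow> 'g set \<Rightarrow> nat \<Rightarrow>
    ('g \<Rightarrow> 'g list \<Rightarrow> 'k::field) set \<Rightarrow> ('g \<Rightarrow> 'g list \<Rightarrow> 'k) set set" where
  "deRham_class G C n \<omega> = coboundaries G C n +>\<^bsub>Omega G C\<^esub> \<omega>"

section \<open>The 2-cycles of the symmetric group\<close>

definition two_cycles :: "nat \<Rightarrow> (nat \<Rightarrow> nat) set" where
  "two_cycles N = {transpose i j | i j. i \<in> {1..N} \<and> j \<in> {1..N} \<and> i \<noteq> j}"

end

theory Submission
  imports Defs
begin

text \<open>
  A 1-form \<open>\<Sum>\<^sub>a f\<^sub>a e\<^sub>a\<close> is closed iff the weight \<open>f\<^sub>a(g)\<close> on the edges \<open>g \<rightarrow> g a\<close> of the Cayley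
  graph has the same sum along the paths \<open>a, b\<close> and \<open>a b a, a\<close>. Two such moves turn \<open>a a b\<close> into
  \<open>b a a\<close> and \<open>a b b\<close> into \<open>c c a\<close> with \<open>c = a b a\<close>, so all loops \<open>a a\<close> have the same weight; half
  of it is the multiple of \<open>\<theta>\<close> to be subtracted. For the rest \<open>a a\<close> can be cancelled. Any word in
  the 2-cycles of \<open>S\<^sub>m\<^sub>+\<^sub>1\<close> then reduces to a word in those of \<open>S\<^sub>m\<close> followed by at most one
  \<open>(i m+1)\<close>, which is absent if the product is trivial. Hence closed paths have weight zero and the
  form is exact. Finally, \<open>\<theta>\<close> is not exact, since exact forms vanish on the loops \<open>a a\<close>.
\<close>

text \<open>Otherwise the simplifier turns the degree in \<open>cocycles G C 1\<close> into
  \<open>Suc 0\<close>, and rules stated for degree \<open>1\<close> no longer match.\<close>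

declare One_nat_def [simp del]

section \<open>Flat weights on the Cayley graph\<close>

lemma two_cycles_permutes: "a \<in> two_cycles N \<Longrightarrow> a permutes {1..N}"
  by (auto simp: two_cycles_def intro!: permutes_swap_id)

lemma two_cycles_involution: "a \<in> two_cycles N \<Longrightarrow> a \<circ> a = id"
  by (auto simp: two_cycles_def)

lemma two_cycles_mono: "m \<le> N \<Longrightarrow> two_cycles m \<subseteq> two_cycles N"
  by (fastforce simp: two_cycles_def)

text \<open>Conjugation relabels the two swapped points; an involution \<open>a\<close> is its own
  inverse, so the composite is a conjugate.\<close>

lemma transpose_conj_involution:
  assumes "a \<circ> a = id"
  shows "a \<circ> transpose i j \<circ> a = transpose (a i) (a j)"
proof -
  have aa: "a (a x) = x" for x using assms by (metis comp_apply id_apply)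
  have "a x = i \<longleftrightarrow> x = a i" "a x = j \<longleftrightarrow> x = a j" for x using aa by metis+
  then show ?thesis by (intro ext) (simp add: transpose_def aa)
qed

lemma two_cycles_conj:
  assumes "a permutes {1..N}" "a \<circ> a = id" "b \<in> two_cycles N"
  shows "a \<circ> b \<circ> a \<in> two_cycles N"
proof -
  obtain i j where b: "b = transpose i j" "i \<in> {1..N}" "j \<in> {1..N}" "i \<noteq> j"
    using assms(3) by (auto simp: two_cycles_def)
  have "a i \<in> {1..N}" "a j \<in> {1..N}"
    using b permutes_in_image[OF assms(1)] by blast+
  moreover have "a i \<noteq> a j" using b permutes_inj[OF assms(1)] by (simp add: inj_eq)
  ultimately show ?thesis
    unfolding b(1) transpose_conj_involution[OF assms(2)] two_cycles_def by blast
qed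

text \<open>All 2-cycles are conjugate, phrased as an induction principle. The endpoints can be
  replaced one at a time, since conjugating \<open>(i j)\<close> by \<open>(j k)\<close> gives
  \<open>(i k)\<close>.\<close>

lemma two_cycles_conj_trans:
  assumes "a \<in> two_cycles N" "b \<in> two_cycles N"
    and step: "\<And>a b. \<lbrakk>a \<in> two_cycles N; b \<in> two_cycles N\<rbrakk> \<Longrightarrow> P b \<Longrightarrow> P (a \<circ> b \<circ> a)"
    and "P b"
  shows "P a"
proof -
  have move: "P (transpose i k)"
    if "P (transpose i j)" "i \<in> {1..N}" "j \<in> {1..N}" "k \<in> {1..N}" "i \<noteq> j" "i \<noteq> k" for i j k
  proof (cases "j = k")
    case False
    have "transpose j k \<circ> transpose i j \<circ> transpose j k = transpose i k"
      using that False by (auto simp: fun_eq_iff transpose_def)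
    moreover have "P (transpose j k \<circ> transpose i j \<circ> transpose j k)"
      using that False by (intro step) (auto simp: two_cycles_def)
    ultimately show ?thesis by simp
  qed (use that in simp)
  obtain i j where b: "b = transpose i j" "i \<in> {1..N}" "j \<in> {1..N}" "i \<noteq> j"
    using assms(2) by (auto simp: two_cycles_def)
  obtain k l where a: "a = transpose k l" "k \<in> {1..N}" "l \<in> {1..N}" "k \<noteq> l"
    using assms(1) by (auto simp: two_cycles_def)
  show ?thesis
  proof (cases "k = i")
    case True
    then show ?thesis unfolding a(1) using move[of i j l] a(2-) b \<open>P b\<close> by blast
  next
    case False
    \<comment> \<open>Replace \<open>j\<close> by \<open>k\<close> first; by symmetry of the 2-cycle
      the other endpoint \<open>i\<close> can then be replaced by \<open>l\<close>.\<close>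
    have "P (transpose i k)" by (rule move[of i j k]) (use a b \<open>P b\<close> False in auto)
    then have "P (transpose k i)" by (metis transpose_commute)
    then show ?thesis unfolding a(1) using move[of k i l] a(2-) b False by blast
  qed
qed

section \<open>Words as paths in the Cayley graph\<close>

primrec comp_list :: "('a \<Rightarrow> 'a) list \<Rightarrow> 'a \<Rightarrow> 'a" where
  "comp_list [] = id"
| "comp_list (a # w) = a \<circ> comp_list w"

lemma comp_list_append: "comp_list (u @ v) = comp_list u \<circ> comp_list v"
  by (induction u) (auto simp: comp_assoc)

lemma comp_list_permutes:
  "w \<in> lists (two_cycles N) \<Longrightarrow> comp_list w permutes {1..N}"
  by (induction w) (auto intro: permutes_compose two_cycles_permutes permutes_id)

lemma comp_list_rev:
  "w \<in> lists (two_cycles N) \<Longrightarrow> comp_list w \<circ> comp_list (rev w) = id"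
proof (induction w)
  case (Cons a w)
  have "comp_list (a # w) \<circ> comp_list (rev (a # w)) = a \<circ> (comp_list w \<circ> comp_list (rev w)) \<circ> a"
    by (simp add: comp_list_append comp_assoc)
  also have "comp_list w \<circ> comp_list (rev w) = id" using Cons.prems by (intro Cons.IH) simp
  also have "a \<circ> id \<circ> a = id" using Cons two_cycles_involution[of a N] by simp
  finally show ?case .
qed simp

lemma two_cycles_generate:
  assumes "p permutes {1..N}"
  shows "\<exists>w \<in> lists (two_cycles N). comp_list w = p"
  using assms finite_atLeastAtMost
proof (induction rule: permutes_induct)
  case id
  show ?case by (intro bexI[of _ "[]"]) auto
next
  case (swap a b p)
  then obtain w where "w \<in> lists (two_cycles N)" "comp_list w = p" by auto
  then show ?case using swap
    by (intro bexI[of _ "transpose a b # w"]) (auto simp: two_cycles_def)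
qed

text \<open>A discrete line integral: \<open>f a g\<close> is the weight of the edge from
  \<open>g\<close> to \<open>g \<circ> a\<close>, and the path spelled by \<open>w\<close> ends at
  \<open>g \<circ> comp_list w\<close>.\<close>

primrec path_sum :: "(('a \<Rightarrow> 'a) \<Rightarrow> ('a \<Rightarrow> 'a) \<Rightarrow> 'k) \<Rightarrow> ('a \<Rightarrow> 'a) \<Rightarrow> ('a \<Rightarrow> 'a) list \<Rightarrow> 'k::comm_monoid_add" where
  "path_sum f g [] = 0"
| "path_sum f g (a # w) = f a g + path_sum f (g \<circ> a) w"

lemma path_sum_append:
  "path_sum f g (u @ v) = path_sum f g u + path_sum f (g \<circ> comp_list u) v"
  by (induction u arbitrary: g) (auto simp: add.assoc comp_assoc)

text \<open>The identity that closedness of a 1-form imposes on its coefficients, with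
  \<open>a\<close> in place of its inverse since 2-cycles are involutions.\<close>

locale flat_weight =
  fixes N :: nat and f :: "(nat \<Rightarrow> nat) \<Rightarrow> (nat \<Rightarrow> nat) \<Rightarrow> 'k::field_char_0"
  assumes flat: "\<lbrakk>g permutes {1..N}; a \<in> two_cycles N; b \<in> two_cycles N\<rbrakk>
    \<Longrightarrow> f a g + f b (g \<circ> a) = f (a \<circ> b \<circ> a) g + f a (g \<circ> (a \<circ> b \<circ> a))"
begin

text \<open>A discrete homotopy of paths. Equality is required from every starting point so that the
  relation survives a common prefix, which shifts the base point.\<close>

definition weq :: "(nat \<Rightarrow> nat) list \<Rightarrow> (nat \<Rightarrow> nat) list \<Rightarrow> bool" (infix "\<approx>" 50) where
  "u \<approx> v \<longleftrightarrow> comp_list u = comp_list v \<and>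
    (\<forall>g. g permutes {1..N} \<longrightarrow> path_sum f g u = path_sum f g v)"

lemma weq_refl: "u \<approx> u" by (simp add: weq_def)

lemma weq_trans [trans]: "u \<approx> v \<Longrightarrow> v \<approx> w \<Longrightarrow> u \<approx> w" by (simp add: weq_def)

lemma weq_sym: "u \<approx> v \<Longrightarrow> v \<approx> u" by (simp add: weq_def)

lemma weq_cong:
  assumes "x \<in> lists (two_cycles N)" "u \<approx> v"
  shows "x @ u @ y \<approx> x @ v @ y"
  using assms comp_list_permutes[OF assms(1)]
  by (auto simp: weq_def comp_list_append path_sum_append permutes_compose)

lemma weq_braid:
  assumes "a \<in> two_cycles N" "b \<in> two_cycles N"
  shows "[a, b] \<approx> [a \<circ> b \<circ> a, a]"
  using flat assms two_cycles_involution[OF assms(1)] by (auto simp: weq_def comp_assoc)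

text \<open>\<open>weq_braid\<close> for \<open>b\<close> and \<open>b \<circ> a \<circ> b\<close>,
  read backwards: a letter can also move to the left, conjugating the one it passes.\<close>

lemma weq_braid':
  assumes "a \<in> two_cycles N" "b \<in> two_cycles N"
  shows "[a, b] \<approx> [b, b \<circ> a \<circ> b]"
proof -
  have i: "b \<circ> (b \<circ> a \<circ> b) \<circ> b = a"
    by (metis assms(2) comp_assoc comp_id id_comp two_cycles_involution)
  have "b \<circ> a \<circ> b \<in> two_cycles N"
    using assms by (intro two_cycles_conj two_cycles_permutes two_cycles_involution)
  from weq_braid[OF assms(2) this] show ?thesis unfolding i by (rule weq_sym)
qed

text \<open>Two braid moves bring \<open>b\<close> to the front of \<open>[a, a, b]\<close> and
  conjugate it twice by \<open>a\<close>, which gives \<open>b\<close> back. Both paths contain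
  \<open>f b g\<close>, because \<open>a \<circ> a\<close> returns to \<open>g\<close>.\<close>

lemma loop_const:
  assumes "g permutes {1..N}" "a \<in> two_cycles N" "b \<in> two_cycles N"
  shows "f a (g \<circ> b) + f a (g \<circ> b \<circ> a) = f a g + f a (g \<circ> a)"
proof -
  let ?c = "a \<circ> b \<circ> a"
  have c: "?c \<in> two_cycles N"
    using assms by (intro two_cycles_conj two_cycles_permutes two_cycles_involution)
  have aca: "a \<circ> ?c \<circ> a = b"
    by (metis assms(2) comp_assoc comp_id id_comp two_cycles_involution)
  have "[a, a, b] \<approx> [a, ?c, a]"
    using weq_cong[OF _ weq_braid[OF assms(2,3)], of "[a]" "[]"] assms by simp
  also have "\<dots> \<approx> [b, a, a]"
    using weq_cong[OF _ weq_braid[OF assms(2) c], of "[]" "[a]"] assms unfolding aca by simp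
  finally have "path_sum f g [a, a, b] = path_sum f g [b, a, a]"
    using assms(1) by (simp add: weq_def)
  then show ?thesis using two_cycles_involution[OF assms(2)] by (simp add: comp_assoc)
qed

text \<open>Moving \<open>a\<close> from the front of \<open>[a, b, b]\<close> to the end conjugates
  both copies of \<open>b\<close>. The loop of the conjugate returns to \<open>g\<close>, so
  \<open>f a g\<close> cancels.\<close>

lemma loop_conj:
  assumes "g permutes {1..N}" "a \<in> two_cycles N" "b \<in> two_cycles N"
  shows "f (a \<circ> b \<circ> a) g + f (a \<circ> b \<circ> a) (g \<circ> (a \<circ> b \<circ> a)) = f b (g \<circ> a) + f b (g \<circ> a \<circ> b)"
proof -
  let ?c = "a \<circ> b \<circ> a"
  have c: "?c \<in> two_cycles N"
    using assms by (intro two_cycles_conj two_cycles_permutes two_cycles_involution)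
  have "[a, b, b] \<approx> [?c, a, b]"
    using weq_cong[OF _ weq_braid[OF assms(2,3)], of "[]" "[b]"] assms by simp
  also have "\<dots> \<approx> [?c, ?c, a]"
    using weq_cong[OF _ weq_braid[OF assms(2,3)], of "[?c]" "[]"] c by simp
  finally have "path_sum f g [a, b, b] = path_sum f g [?c, ?c, a]"
    using assms(1) by (simp add: weq_def)
  then have "f a g + (f b (g \<circ> a) + f b (g \<circ> a \<circ> b)) = f ?c g + (f ?c (g \<circ> ?c) + f a (g \<circ> (?c \<circ> ?c)))"
    by (simp only: path_sum.simps add_0_right comp_assoc)
  then show ?thesis unfolding two_cycles_involution[OF c] by simp
qed

text \<open>The base point is moved to \<open>id\<close> along a word (\<open>loop_const\<close>);
  there the 2-cycles are exchanged by conjugation (\<open>loop_conj\<close>).\<close>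

lemma loop_eq:
  assumes "g permutes {1..N}" "g' permutes {1..N}" "a \<in> two_cycles N" "b \<in> two_cycles N"
  shows "f a g + f a (g \<circ> a) = f b g' + f b (g' \<circ> b)"
proof -
  have word: "f a (g \<circ> comp_list w) + f a (g \<circ> comp_list w \<circ> a) = f a g + f a (g \<circ> a)"
    if "w \<in> lists (two_cycles N)" "g permutes {1..N}" "a \<in> two_cycles N" for w g a
    using that
  proof (induction w arbitrary: g rule: list.induct)
    case Nil
    then show ?case by simp
  next
    case (Cons b w)
    have "g \<circ> b permutes {1..N}"
      using Cons.prems two_cycles_permutes[of b N] by (intro permutes_compose) auto
    then show ?case using Cons.prems Cons.IH[of "\<lambda>x. g (b x)"] loop_const[of g a b]
      by (simp add: comp_def)
  qed
  have to_id: "f a g + f a (g \<circ> a) = f a id + f a a"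
    if ga: "g permutes {1..N}" "a \<in> two_cycles N" for a g
  proof -
    obtain w where "w \<in> lists (two_cycles N)" "comp_list w = g"
      using two_cycles_generate[OF ga(1)] by blast
    then show ?thesis using word[of w id a] ga by (simp add: permutes_id)
  qed
  have "f a id + f a a = f b id + f b b"
  proof (rule two_cycles_conj_trans[OF assms(3,4), of "\<lambda>x. f x id + f x x = f b id + f b b"])
    fix x y assume xy: "x \<in> two_cycles N" "y \<in> two_cycles N"
      and *: "f y id + f y y = f b id + f b b"
    \<comment> \<open>Conjugation by \<open>x\<close> moves the base point from \<open>id\<close> to
      \<open>x\<close>; \<open>to_id\<close> brings it back.\<close>
    have "f (x \<circ> y \<circ> x) id + f (x \<circ> y \<circ> x) (x \<circ> y \<circ> x) = f y x + f y (x \<circ> y)"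
      using loop_conj[of id x y] xy by (simp add: permutes_id)
    also have "\<dots> = f y id + f y y" using to_id[of x y] xy two_cycles_permutes by simp
    finally show "f (x \<circ> y \<circ> x) id + f (x \<circ> y \<circ> x) (x \<circ> y \<circ> x) = f b id + f b b" using * by simp
  qed simp
  then show ?thesis using to_id assms by simp
qed

end

text \<open>Going along an edge and back costs nothing, so \<open>[a, a]\<close> can be deleted from
  a word. Subtracting the right constant from a flat weight leads here.\<close>

locale balanced_flat_weight = flat_weight +
  assumes balanced: "\<lbrakk>g permutes {1..N}; a \<in> two_cycles N\<rbrakk> \<Longrightarrow> f a g + f a (g \<circ> a) = 0"
begin

lemma weq_cancel: "a \<in> two_cycles N \<Longrightarrow> [a, a] \<approx> []"
  using balanced two_cycles_involution by (auto simp: weq_def)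

text \<open>The identity and the 2-cycles \<open>transpose i (Suc m)\<close> represent the cosets of
  \<open>S_m\<close> in \<open>S_(m+1)\<close>. Braid moves and cancellation suffice to reach this
  normal form, so path sums are preserved.\<close>

lemma word_reduce:
  assumes "Suc m \<le> N" "w \<in> lists (two_cycles (Suc m))"
  shows "\<exists>v \<in> lists (two_cycles m). w \<approx> v \<or> (\<exists>i \<in> {1..m}. w \<approx> v @ [transpose i (Suc m)])"
  using assms(2)
proof (induction w rule: rev_induct)
  case Nil
  show ?case by (intro bexI[of _ "[]"]) (auto simp: weq_refl)
next
  case (snoc t w)
  let ?M = "Suc m"
  have sub: "two_cycles m \<subseteq> two_cycles N" "two_cycles ?M \<subseteq> two_cycles N"
    using two_cycles_mono assms(1) by (meson Suc_leD)+
  have t: "t \<in> two_cycles m \<or> (\<exists>j \<in> {1..m}. t = transpose j ?M)"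
  proof -
    obtain i j where ij: "t = transpose i j" "i \<in> {1..?M}" "j \<in> {1..?M}" "i \<noteq> j"
      using snoc.prems by (auto simp: two_cycles_def)
    consider "i = ?M" | "j = ?M" | "i \<noteq> ?M" "j \<noteq> ?M" by blast
    then show ?thesis
    proof cases
      case 1
      then have "t = transpose j ?M" "j \<in> {1..m}" using ij transpose_commute[of i j] by auto
      then show ?thesis by blast
    next
      case 2
      then have "t = transpose i ?M" "i \<in> {1..m}" using ij by auto
      then show ?thesis by blast
    next
      case 3
      then have "i \<in> {1..m}" "j \<in> {1..m}" using ij by auto
      then show ?thesis unfolding two_cycles_def using ij by blast
    qed
  qed
  have tM: "transpose i ?M \<in> two_cycles N" if "i \<in> {1..m}" for i
  proof -
    have "i \<in> {1..N}" "?M \<in> {1..N}" "i \<noteq> ?M" using that assms(1) by auto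
    then show ?thesis unfolding two_cycles_def by blast
  qed
  have snoc_cong: "w @ [t] \<approx> u @ [t]" if "w \<approx> u" for u
    using weq_cong[of "[]" w u "[t]"] that by simp
  obtain v where v: "v \<in> lists (two_cycles m)" and
    w: "w \<approx> v \<or> (\<exists>i \<in> {1..m}. w \<approx> v @ [transpose i ?M])"
    using snoc by auto
  have vN: "v \<in> lists (two_cycles N)" using v sub by auto
  show ?case
  proof (cases "w \<approx> v")
    case True
    then have wt: "w @ [t] \<approx> v @ [t]" by (rule snoc_cong)
    from t show ?thesis
    proof
      assume "t \<in> two_cycles m"
      then show ?thesis using wt v by (intro bexI[of _ "v @ [t]"]) auto
    qed (use wt v in blast)
  next
    case False
    then obtain i where i: "i \<in> {1..m}" "w \<approx> v @ [transpose i ?M]" using w by auto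
    let ?u = "transpose i ?M"
    have wt: "w @ [t] \<approx> v @ [?u, t]" using snoc_cong[OF i(2)] by simp
    have cong: "w @ [t] \<approx> v @ z" if "[?u, t] \<approx> z" for z
      using weq_trans[OF wt, of "v @ z"] weq_cong[OF vN that, of "[]"] by simp
    consider "t \<in> two_cycles m" | "t = ?u" | j where "j \<in> {1..m}" "j \<noteq> i" "t = transpose j ?M"
      using t by blast
    then show ?thesis
    proof cases
      case 1
      \<comment> \<open>\<open>t\<close> fixes \<open>Suc m\<close>, so moving it left past
        \<open>?u\<close> only changes \<open>i\<close> to \<open>t i\<close>.\<close>
      have p: "t permutes {1..m}" using 1 by (rule two_cycles_permutes)
      have "t ?M = ?M" using permutes_not_in[OF p, of ?M] by simp
      then have "t \<circ> ?u \<circ> t = transpose (t i) ?M"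
        using transpose_conj_involution[OF two_cycles_involution[OF 1], of i ?M] by simp
      then have "w @ [t] \<approx> v @ [t, transpose (t i) ?M]"
        using weq_braid'[OF tM[OF i(1)], of t] 1 sub(1) by (intro cong) (auto simp: subset_iff)
      moreover have "t i \<in> {1..m}" using permutes_in_image[OF p, of i] i(1) by blast
      ultimately show ?thesis using 1 v by (intro bexI[of _ "v @ [t]"] disjI2) auto
    next
      case 2
      then have "w @ [t] \<approx> v @ []" using weq_cancel[OF tM[OF i(1)]] by (intro cong) simp
      then show ?thesis using v by auto
    next
      case 3
      \<comment> \<open>Moving \<open>?u\<close> right past \<open>t\<close> leaves a single letter
        that involves the top point \<open>?M\<close>.\<close>
      have "?u \<circ> t \<circ> ?u = transpose i j"
        unfolding 3(3) by (rule ext) (use i(1) 3(1,2) in \<open>auto simp: transpose_def\<close>)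
      then have "w @ [t] \<approx> v @ [transpose i j, ?u]"
        using weq_braid[OF tM[OF i(1)] tM[OF 3(1)]] 3(3) by (intro cong) simp
      moreover have "transpose i j \<in> two_cycles m" using i(1) 3(1,2) unfolding two_cycles_def by blast
      ultimately show ?thesis using i(1) v by (intro bexI[of _ "v @ [transpose i j]"] disjI2) auto
    qed
  qed
qed

text \<open>Descent on \<open>m\<close>: a trailing \<open>transpose i (Suc m)\<close> would force
  the product of a word over \<open>two_cycles m\<close> to send \<open>i\<close> to
  \<open>Suc m\<close>. So the normal form is a closed word over the smaller symmetric
  group.\<close>

lemma closed_word_sum:
  assumes "m \<le> N" "w \<in> lists (two_cycles m)" "comp_list w = id" "g permutes {1..N}"
  shows "path_sum f g w = 0"
  using assms
proof (induction m arbitrary: w)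
  case 0
  then have "w = []" by (cases w) (auto simp: two_cycles_def)
  then show ?case by simp
next
  case (Suc m)
  obtain v where v: "v \<in> lists (two_cycles m)"
    and w: "w \<approx> v \<or> (\<exists>i \<in> {1..m}. w \<approx> v @ [transpose i (Suc m)])"
    using word_reduce[OF Suc.prems(1,2)] by auto
  have "\<not> w \<approx> v @ [transpose i (Suc m)]" if i: "i \<in> {1..m}" for i
  proof
    assume "w \<approx> v @ [transpose i (Suc m)]"
    then have "comp_list w = comp_list v \<circ> transpose i (Suc m)"
      by (simp add: weq_def comp_list_append)
    then have "comp_list v \<circ> transpose i (Suc m) = id" using Suc.prems(3) by metis
    then have "comp_list v i = Suc m" by (metis comp_apply id_apply transpose_apply_second)
    then show False using permutes_in_image[OF comp_list_permutes[OF v], of i] i by simp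
  qed
  with w have "w \<approx> v" by blast
  then show ?case using Suc v by (simp add: weq_def)
qed

text \<open>The potential \<open>h\<close> integrates \<open>f\<close> from \<open>id\<close> along
  a chosen word; vanishing on closed words makes the value independent of the choice.\<close>

lemma exact:
  "\<exists>h. \<forall>g a. g permutes {1..N} \<longrightarrow> a \<in> two_cycles N \<longrightarrow> f a g = h (g \<circ> a) - h g"
proof -
  define word where "word p = (SOME w. w \<in> lists (two_cycles N) \<and> comp_list w = p)" for p
  have word: "word p \<in> lists (two_cycles N)" "comp_list (word p) = p" if "p permutes {1..N}" for p
    using someI_ex[of "\<lambda>w. w \<in> lists (two_cycles N) \<and> comp_list w = p"] two_cycles_generate[OF that]
    by (auto simp: word_def)
  have unique: "path_sum f id u = path_sum f id v"
    if "u \<in> lists (two_cycles N)" "v \<in> lists (two_cycles N)" "comp_list u = comp_list v" for u v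
  proof -
    \<comment> \<open>\<open>x\<close> stands for both \<open>u\<close> and \<open>v\<close>: each
      is closed up by the same return path, whose contribution then cancels.\<close>
    have "path_sum f id (x @ rev v) = 0" if "x \<in> lists (two_cycles N)" "comp_list x = comp_list v" for x
      using that comp_list_rev[OF \<open>v \<in> _\<close>] \<open>v \<in> _\<close>
      by (intro closed_word_sum[OF order_refl])
         (auto simp: comp_list_append permutes_id)
    from this[of u] this[of v] that have
      "path_sum f id u + path_sum f (comp_list v) (rev v)
        = path_sum f id v + path_sum f (comp_list v) (rev v)"
      by (simp add: path_sum_append)
    then show ?thesis by (rule add_right_imp_eq)
  qed
  have "f a g = path_sum f id (word (g \<circ> a)) - path_sum f id (word g)"
    if "g permutes {1..N}" "a \<in> two_cycles N" for g a
  proof -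
    have ga: "g \<circ> a permutes {1..N}" using that by (auto intro: permutes_compose two_cycles_permutes)
    have "path_sum f id (word (g \<circ> a)) = path_sum f id (word g @ [a])"
      using word[OF ga] word[OF that(1)] that(2)
      by (intro unique) (auto simp: comp_list_append)
    then show ?thesis using word[OF that(1)] by (simp add: path_sum_append)
  qed
  then show ?thesis by (intro exI[of _ "\<lambda>g. path_sum f id (word g)"]) simp
qed

end

theorem (in flat_weight) flat_imp_const_plus_exact:
  "\<exists>c h. \<forall>g a. g permutes {1..N} \<longrightarrow> a \<in> two_cycles N \<longrightarrow> f a g = c + (h (g \<circ> a) - h g)"
proof (cases "two_cycles N = {}")
  case False
  then obtain b where b: "b \<in> two_cycles N" by blast
  \<comment> \<open>An exact weight sums to zero around \<open>[a, a]\<close> and a constant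
    \<open>c\<close> to \<open>2 * c\<close>, so \<open>c\<close> must be half the common loop
    weight.\<close>
  define c where "c = (f b id + f b b) / 2"
  have loop: "f a g + f a (g \<circ> a) = 2 * c" if "g permutes {1..N}" "a \<in> two_cycles N" for g a
    using loop_eq[OF that(1) permutes_id that(2) b] by (simp add: c_def)
  have "balanced_flat_weight N (\<lambda>a g. f a g - c)"
  proof
    fix g a b assume "g permutes {1..N}" "a \<in> two_cycles N" "b \<in> two_cycles N"
    from flat[OF this] show "f a g - c + (f b (g \<circ> a) - c) =
      f (a \<circ> b \<circ> a) g - c + (f a (g \<circ> (a \<circ> b \<circ> a)) - c)" by (simp add: algebra_simps)
  next
    fix g a assume "g permutes {1..N}" "a \<in> two_cycles N"
    from loop[OF this] show "f a g - c + (f a (g \<circ> a) - c) = 0" by (simp add: algebra_simps)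
  qed
  from balanced_flat_weight.exact[OF this] obtain h
    where h: "\<forall>g a. g permutes {1..N} \<longrightarrow> a \<in> two_cycles N \<longrightarrow> f a g - c = h (g \<circ> a) - h g"
    by (elim exE)
  have "f a g = c + (h (g \<circ> a) - h g)" if "g permutes {1..N}" "a \<in> two_cycles N" for g a
    using h[rule_format, OF that] by (metis add_diff_cancel_left' diff_add_cancel add.commute)
  then show ?thesis by (intro exI[of _ c] exI[of _ h]) simp
qed simp

section \<open>Homogeneous elements and the quadratic relations\<close>

definition form0 :: "('g, 'm) monoid_scheme \<Rightarrow> ('g \<Rightarrow> 'k) \<Rightarrow> 'g \<Rightarrow> 'g list \<Rightarrow> 'k::field" where
  "form0 G h = tens G h (word_basis [])"

text \<open>The cut-off outside \<open>carrier G\<close> and \<open>C\<close> lets an arbitrary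
  \<open>f\<close> serve as coefficients.\<close>

definition form1 :: "('g, 'm) monoid_scheme \<Rightarrow> 'g set \<Rightarrow> ('g \<Rightarrow> 'g \<Rightarrow> 'k) \<Rightarrow> 'g \<Rightarrow> 'g list \<Rightarrow> 'k::field" where
  "form1 G C f = (\<lambda>g w. case w of [a] \<Rightarrow> if g \<in> carrier G \<and> a \<in> C then f a g else 0 | _ \<Rightarrow> 0)"

definition form2 :: "('g, 'm) monoid_scheme \<Rightarrow> 'g set \<Rightarrow> ('g \<Rightarrow> 'g \<Rightarrow> 'g \<Rightarrow> 'k) \<Rightarrow> 'g \<Rightarrow> 'g list \<Rightarrow> 'k::field" where
  "form2 G C F = (\<lambda>g w. case w of [a, b] \<Rightarrow> if g \<in> carrier G \<and> a \<in> C \<and> b \<in> C then F a b g else 0 | _ \<Rightarrow> 0)"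

lemma form0_nonzero: "form0 G h g w \<noteq> 0 \<Longrightarrow> length w = 0 \<and> g \<in> carrier G \<and> w \<in> lists C"
  by (auto simp: form0_def tens_def word_basis_def split: if_splits)

lemma form1_nonzero: "form1 G C f g w \<noteq> 0 \<Longrightarrow> length w = 1 \<and> g \<in> carrier G \<and> w \<in> lists C"
  by (auto simp: form1_def split: list.splits if_splits)

lemma form2_nonzero: "form2 G C F g w \<noteq> 0 \<Longrightarrow> length w = 2 \<and> g \<in> carrier G \<and> w \<in> lists C"
  by (auto simp: form2_def split: list.splits if_splits)

text \<open>Finite support is automatic: a finite \<open>C\<close> has finitely many words of length
  \<open>n\<close>.\<close>

lemma cross_alg_homogeneousI:
  assumes "finite C" "\<And>g w. x g w \<noteq> 0 \<Longrightarrow> length w = n \<and> g \<in> carrier G \<and> w \<in> lists C"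
  shows "x \<in> carrier (cross_alg G C)"
proof -
  have "{w. \<exists>g. x g w \<noteq> 0} \<subseteq> {w. set w \<subseteq> C \<and> length w = n}" using assms(2) by fastforce
  then have "finite {w. \<exists>g. x g w \<noteq> 0}"
    by (rule finite_subset) (rule finite_lists_length_eq[OF assms(1)])
  then show ?thesis using assms(2) by (fastforce simp: cross_alg_def)
qed

text \<open>Only the split of \<open>w\<close> after \<open>m\<close> letters can
  contribute.\<close>

lemma cross_alg_mult_homogeneous:
  fixes x y :: "'g \<Rightarrow> 'g list \<Rightarrow> 'k::field"
  assumes "\<And>g w. x g w \<noteq> 0 \<Longrightarrow> length w = m" "\<And>g w. y g w \<noteq> 0 \<Longrightarrow> length w = n"
  shows "(x \<otimes>\<^bsub>cross_alg G C\<^esub> y) g w =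
    (if length w = m + n then x g (take m w) * y (g \<otimes>\<^bsub>G\<^esub> word_prod G (take m w)) (drop m w) else 0)"
proof -
  let ?t = "\<lambda>i. x g (take i w) * y (g \<otimes>\<^bsub>G\<^esub> word_prod G (take i w)) (drop i w)"
  have "?t i = (if i = m then if length w = m + n then ?t m else 0 else 0)" if "i \<le> length w" for i
  proof (cases "?t i = 0")
    case False
    then have "x g (take i w) \<noteq> 0" "y (g \<otimes>\<^bsub>G\<^esub> word_prod G (take i w)) (drop i w) \<noteq> 0" by auto
    then have "length (take i w) = m" "length (drop i w) = n" by (blast intro: assms)+
    then show ?thesis using that by auto
  qed auto
  then have "(\<Sum>i\<le>length w. ?t i)
      = (\<Sum>i\<le>length w. if i = m then if length w = m + n then ?t m else 0 else 0)"
    by (intro sum.cong) auto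
  then show ?thesis by (simp add: cross_alg_def)
qed

locale conj_stable = group G for G (structure) +
  fixes C
  assumes finite_C: "finite C" and C_carrier: "C \<subseteq> carrier G"
    and conj_C: "\<lbrakk>a \<in> C; b \<in> C\<rbrakk> \<Longrightarrow> a \<otimes> b \<otimes> inv a \<in> C"
begin

lemma C_closed [simp]: "a \<in> C \<Longrightarrow> a \<in> carrier G"
  using C_carrier by blast

lemma form_carrier:
  "form0 G h \<in> carrier (cross_alg G C)" "form1 G C f \<in> carrier (cross_alg G C)"
  "form2 G C F \<in> carrier (cross_alg G C)"
  by (rule cross_alg_homogeneousI[OF finite_C], erule form0_nonzero form1_nonzero form2_nonzero)+

lemma homogeneous0:
  assumes "x \<in> carrier (cross_alg G C)" "\<And>g w. x g w \<noteq> 0 \<Longrightarrow> length w = 0"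
  shows "x = form0 G (\<lambda>g. x g [])"
proof (intro ext)
  fix g w
  show "x g w = form0 G (\<lambda>g. x g []) g w"
    using cross_alg_carrierD[OF assms(1), of g w] assms(2)[of g w]
    by (cases "x g w = 0") (auto simp: form0_def tens_def word_basis_def)
qed

lemma homogeneous1:
  assumes "x \<in> carrier (cross_alg G C)" "\<And>g w. x g w \<noteq> 0 \<Longrightarrow> length w = 1"
  shows "x = form1 G C (\<lambda>a g. x g [a])"
proof (intro ext)
  fix g w
  show "x g w = form1 G C (\<lambda>a g. x g [a]) g w"
  proof (cases "length w = 1")
    case True
    then obtain a where "w = [a]" by (metis length_0_conv length_Suc_conv One_nat_def)
    then show ?thesis using cross_alg_carrierD[OF assms(1), of g w] by (auto simp: form1_def)
  next
    case False
    then show ?thesis using assms(2)[of g w] form1_nonzero[of G C _ g w] by metis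
  qed
qed

lemma form_add:
  "form1 G C f \<oplus>\<^bsub>cross_alg G C\<^esub> form1 G C f' = form1 G C (\<lambda>a g. f a g + f' a g)"
  "form2 G C F \<oplus>\<^bsub>cross_alg G C\<^esub> form2 G C F' = form2 G C (\<lambda>a b g. F a b g + F' a b g)"
  by (auto simp: cross_alg_def form1_def form2_def fun_eq_iff split: list.splits)

lemma form0_mult_form1:
  "form0 G h \<otimes>\<^bsub>cross_alg G C\<^esub> form1 G C f = form1 G C (\<lambda>a g. h g * f a g)"
proof (intro ext)
  fix g w
  show "(form0 G h \<otimes>\<^bsub>cross_alg G C\<^esub> form1 G C f) g w = form1 G C (\<lambda>a g. h g * f a g) g w"
    by (subst cross_alg_mult_homogeneous[of _ 0 _ 1])
       (auto simp: form0_def form1_def tens_def word_basis_def word_prod_def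
         split: list.splits if_splits)
qed

text \<open>The shift \<open>g \<otimes> a\<close> is the cross relation carrying \<open>h\<close>
  past the letter \<open>a\<close>.\<close>

lemma form1_mult_form0:
  "form1 G C f \<otimes>\<^bsub>cross_alg G C\<^esub> form0 G h = form1 G C (\<lambda>a g. f a g * h (g \<otimes> a))"
proof (intro ext)
  fix g w
  show "(form1 G C f \<otimes>\<^bsub>cross_alg G C\<^esub> form0 G h) g w = form1 G C (\<lambda>a g. f a g * h (g \<otimes> a)) g w"
    by (subst cross_alg_mult_homogeneous[of _ 1 _ 0])
       (auto simp: form0_def form1_def tens_def word_basis_def word_prod_def
         split: list.splits if_splits)
qed

lemma form1_mult_form1:
  "form1 G C f \<otimes>\<^bsub>cross_alg G C\<^esub> form1 G C f' = form2 G C (\<lambda>a b g. f a g * f' b (g \<otimes> a))"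
proof (intro ext)
  fix g w
  show "(form1 G C f \<otimes>\<^bsub>cross_alg G C\<^esub> form1 G C f') g w
      = form2 G C (\<lambda>a b g. f a g * f' b (g \<otimes> a)) g w"
    by (subst cross_alg_mult_homogeneous[of _ 1 _ 1])
       (auto simp: form1_def form2_def word_prod_def One_nat_def split: list.splits if_splits)
qed

section \<open>The braiding and the quadratic ideal in low degrees\<close>

lemma braiding_conj:
  assumes "a \<in> C" "b \<in> C"
  shows "braiding G C t [a \<otimes> b \<otimes> inv a, a] = t [a, b]"
proof -
  have inj: "b' = b" if "b' \<in> C" "a \<otimes> b \<otimes> inv a = a \<otimes> b' \<otimes> inv a" for b'
    using that assms by (simp add: right_cancel)
  \<comment> \<open>The second letter determines \<open>a\<close>, and conjugation by
    \<open>a\<close> is injective, so a single term of the double sum survives.\<close>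
  have "braiding G C t [a \<otimes> b \<otimes> inv a, a]
      = (\<Sum>a'\<in>C. \<Sum>b'\<in>C. if a' = a then if b' = b then t [a, b] else 0 else 0)"
    unfolding braiding_def by (intro sum.cong refl) (use inj in \<open>auto simp: word_basis_def\<close>)
  also have "\<dots> = t [a, b]"
  proof -
    have "(\<Sum>b'\<in>C. if a' = a then if b' = b then t [a, b] else 0 else 0)
        = (if a' = a then t [a, b] else 0)" for a'
      using assms finite_C by simp
    then show ?thesis using assms finite_C by simp
  qed
  finally show ?thesis .
qed

text \<open>
  An ideal containing \<^const>\<open>quad_ideal\<close> and imposing nothing in degrees above 2. Since
  \<open>a b inv a\<close> followed by \<open>a\<close> has the same product as \<open>a\<close>, \<open>b\<close>, its degree-2 condition survives
  multiplication by functions from the right.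
\<close>

definition quad_bound :: "('a \<Rightarrow> 'a list \<Rightarrow> 'k::field) set" where
  "quad_bound = {x \<in> carrier (cross_alg G C). (\<forall>g w. length w < 2 \<longrightarrow> x g w = 0) \<and>
     (\<forall>g. \<forall>a\<in>C. \<forall>b\<in>C. x g [a \<otimes> b \<otimes> inv a, a] = x g [a, b])}"

lemma ideal_quad_bound: "ideal (quad_bound :: ('a \<Rightarrow> 'a list \<Rightarrow> 'k::field) set) (cross_alg G C)"
proof (rule idealI)
  interpret A: ring "cross_alg G C :: ('a \<Rightarrow> 'a list \<Rightarrow> 'k) ring"
    by (rule ring_cross_alg[OF is_group C_carrier])
  show "ring (cross_alg G C :: ('a \<Rightarrow> 'a list \<Rightarrow> 'k) ring)" by (rule A.ring_axioms)
  show "subgroup quad_bound (add_monoid (cross_alg G C :: ('a \<Rightarrow> 'a list \<Rightarrow> 'k) ring))"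
  proof (rule A.add.subgroupI)
    show "quad_bound \<subseteq> carrier (cross_alg G C :: ('a \<Rightarrow> 'a list \<Rightarrow> 'k) ring)"
      by (auto simp: quad_bound_def)
    have "\<zero>\<^bsub>cross_alg G C\<^esub> \<in> (quad_bound :: ('a \<Rightarrow> 'a list \<Rightarrow> 'k) set)"
      using A.zero_closed by (auto simp: quad_bound_def cross_alg_def)
    then show "(quad_bound :: ('a \<Rightarrow> 'a list \<Rightarrow> 'k) set) \<noteq> {}" by blast
  next
    fix x :: "'a \<Rightarrow> 'a list \<Rightarrow> 'k" assume x: "x \<in> quad_bound"
    then have xA: "x \<in> carrier (cross_alg G C)" by (simp add: quad_bound_def)
    have "(\<lambda>g w. - x g w) \<in> carrier (cross_alg G C)" using xA by (simp add: cross_alg_def)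
    then have "\<ominus>\<^bsub>cross_alg G C\<^esub> x = (\<lambda>g w. - x g w)"
      by (intro A.minus_equality xA) (auto simp: cross_alg_def)
    then show "\<ominus>\<^bsub>cross_alg G C\<^esub> x \<in> quad_bound"
      using x A.a_inv_closed[OF xA] by (auto simp: quad_bound_def)
  next
    fix x y :: "'a \<Rightarrow> 'a list \<Rightarrow> 'k" assume "x \<in> quad_bound" "y \<in> quad_bound"
    then show "x \<oplus>\<^bsub>cross_alg G C\<^esub> y \<in> quad_bound"
      using A.a_closed[of x y] by (auto simp: quad_bound_def) (auto simp: cross_alg_def)
  qed
  fix x y :: "'a \<Rightarrow> 'a list \<Rightarrow> 'k"
  assume x: "x \<in> quad_bound" and y: "y \<in> carrier (cross_alg G C)"
  then have xA: "x \<in> carrier (cross_alg G C)"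
    and low: "\<And>g w. length w < 2 \<Longrightarrow> x g w = 0"
    and sym: "\<And>g a b. \<lbrakk>a \<in> C; b \<in> C\<rbrakk> \<Longrightarrow> x g [a \<otimes> b \<otimes> inv a, a] = x g [a, b]"
    by (auto simp: quad_bound_def)
  have sum2: "(\<Sum>i\<le>length [c, d]. t i) = t 0 + t 1 + (t 2 :: 'k)" for t and c d :: 'a
    by (simp add: numeral_2_eq_2 One_nat_def)
  have "(y \<otimes>\<^bsub>cross_alg G C\<^esub> x) g w = 0" if "length w < 2" for g w
    using that by (auto simp: cross_alg_def low intro!: sum.neutral)
  \<comment> \<open>\<open>x\<close> has no part below degree 2, so only the empty prefix
    contributes, and the factor from \<open>y\<close> does not see the two letters.\<close>
  moreover have yx: "(y \<otimes>\<^bsub>cross_alg G C\<^esub> x) g [c, d] = y g [] * x (g \<otimes> word_prod G []) [c, d]" for g c d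
    unfolding cross_alg_def monoid.simps sum2 by (simp add: low)
  ultimately show "y \<otimes>\<^bsub>cross_alg G C\<^esub> x \<in> quad_bound"
    using A.m_closed[OF y xA] by (simp add: quad_bound_def sym)
  have "(x \<otimes>\<^bsub>cross_alg G C\<^esub> y) g w = 0" if "length w < 2" for g w
    using that by (auto simp: cross_alg_def low intro!: sum.neutral)
  \<comment> \<open>Here only the full prefix contributes, and \<open>y\<close> is evaluated at a
    point that depends on the letters only through their product.\<close>
  moreover have xy: "(x \<otimes>\<^bsub>cross_alg G C\<^esub> y) g [c, d] = x g [c, d] * y (g \<otimes> word_prod G [c, d]) []" for g c d
    unfolding cross_alg_def monoid.simps sum2 by (simp add: low)
  moreover have "word_prod G [a \<otimes> b \<otimes> inv a, a] = word_prod G [a, b]" if "a \<in> C" "b \<in> C" for a b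
    using that by (simp add: word_prod_def m_assoc)
  ultimately show "x \<otimes>\<^bsub>cross_alg G C\<^esub> y \<in> quad_bound"
    using A.m_closed[OF xA y] by (simp add: quad_bound_def sym)
qed

text \<open>By \<open>braiding_conj\<close>, the kernel equation at the word
  \<open>[a \<otimes> b \<otimes> inv a, a]\<close> is the symmetry demanded by
  \<open>quad_bound\<close>.\<close>

lemma kernel_subset_quad_bound:
  "tens G (\<lambda>_. 1) ` ker_id_minus_braiding G C \<subseteq> quad_bound"
proof clarify
  fix t :: "'a list \<Rightarrow> 'k::field" assume t: "t \<in> ker_id_minus_braiding G C"
  then have supp: "\<And>w. t w \<noteq> 0 \<Longrightarrow> w \<in> lists C \<and> length w = 2"
    and ker: "\<And>w. braiding G C t w = t w" by (auto simp: ker_id_minus_braiding_def)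
  have "tens G (\<lambda>_. 1) t \<in> carrier (cross_alg G C)"
    by (rule cross_alg_homogeneousI[OF finite_C, of _ 2])
       (use supp in \<open>auto simp: tens_def split: if_splits\<close>)
  moreover have "t [a \<otimes> b \<otimes> inv a, a] = t [a, b]" if "a \<in> C" "b \<in> C" for a b
    using braiding_conj[OF that, of t] ker by simp
  moreover have "t w = 0" if "length w < 2" for w using supp[of w] that by fastforce
  ultimately show "tens G (\<lambda>_. 1) t \<in> quad_bound" by (auto simp: quad_bound_def tens_def)
qed

lemma quad_ideal_subset_quad_bound: "quad_ideal G C \<subseteq> quad_bound"
  unfolding quad_ideal_def
  by (rule ring.genideal_minimal[OF ring_cross_alg[OF is_group C_carrier] ideal_quad_bound
    kernel_subset_quad_bound])

text \<open>The braiding permutes the words of length 2 over \<open>C\<close>, so it fixes their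
  equally weighted sum. This relation makes \<theta> closed.\<close>

lemma const_form2_in_quad_ideal:
  fixes c :: "'k::field"
  shows "form2 G C (\<lambda>_ _ _. c) \<in> quad_ideal G C"
proof -
  interpret A: ring "cross_alg G C :: ('a \<Rightarrow> 'a list \<Rightarrow> 'k) ring"
    by (rule ring_cross_alg[OF is_group C_carrier])
  define t where "t = (\<lambda>w. if w \<in> lists C \<and> length w = 2 then c else 0)"
  have "braiding G C t w = t w" for w
  proof (cases "w \<in> lists C \<and> length w = 2")
    case True
    then obtain d a where w: "w = [d, a]" "d \<in> C" "a \<in> C"
      by (auto simp: numeral_2_eq_2 length_Suc_conv)
    \<comment> \<open>Injective on a finite set, hence onto: every word \<open>[d, a]\<close> is hit
      by the braiding.\<close>
    have "inj_on (\<lambda>x. a \<otimes> x \<otimes> inv a) C"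
      by (rule inj_onI) (use w in simp)
    then have "(\<lambda>x. a \<otimes> x \<otimes> inv a) ` C = C"
      by (intro endo_inj_surj[OF finite_C]) (use conj_C w in auto)
    then obtain b where "b \<in> C" "d = a \<otimes> b \<otimes> inv a" using w by blast
    then show ?thesis using braiding_conj[of a b t] w by (simp add: t_def)
  next
    case False
    then have "braiding G C t w = 0"
      unfolding braiding_def by (intro sum.neutral ballI) (use conj_C in \<open>auto simp: word_basis_def\<close>)
    then show ?thesis using False by (auto simp: t_def)
  qed
  then have "t \<in> ker_id_minus_braiding G C"
    by (auto simp: ker_id_minus_braiding_def t_def)
  moreover have "tens G (\<lambda>_. 1) t = form2 G C (\<lambda>_ _ _. c)"
    by (auto simp: tens_def form2_def t_def fun_eq_iff split: list.splits)
  ultimately have "form2 G C (\<lambda>_ _ _. c) \<in> tens G (\<lambda>_. 1) ` ker_id_minus_braiding G C"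
    by (metis imageI)
  moreover have "tens G (\<lambda>_. 1) ` ker_id_minus_braiding G C
      \<subseteq> carrier (cross_alg G C :: ('a \<Rightarrow> 'a list \<Rightarrow> 'k) ring)"
    using kernel_subset_quad_bound by (auto simp: quad_bound_def)
  ultimately show ?thesis unfolding quad_ideal_def using A.genideal_self by blast
qed

end


section \<open>The first cohomology\<close>

text \<open>\<open>\<phi>\<close> carries the field, as a vector space over itself, onto
  \<open>H\<close>, and the axioms are transported along it.\<close>

lemma one_dimensional_vectorspace:
  fixes H :: "('k::field, 'v) module" and \<phi> :: "'k \<Rightarrow> 'v"
  assumes inj: "inj \<phi>" and carrier: "carrier H = range \<phi>" and zero: "\<zero>\<^bsub>H\<^esub> = \<phi> 0"
    and add: "\<And>c d. \<phi> c \<oplus>\<^bsub>H\<^esub> \<phi> d = \<phi> (c + d)"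
    and smult: "\<And>c d. c \<odot>\<^bsub>H\<^esub> \<phi> d = \<phi> (c * d)"
  shows "vectorspace class_ring H \<and> vectorspace.dim class_ring H = 1
    \<and> LinearCombinations.module.span class_ring H {\<phi> 1} = carrier H"
proof -
  have grp: "abelian_group H"
  proof (rule abelian_groupI)
    fix x assume "x \<in> carrier H"
    then obtain c where "x = \<phi> c" using carrier by auto
    then show "\<exists>y\<in>carrier H. y \<oplus>\<^bsub>H\<^esub> x = \<zero>\<^bsub>H\<^esub>"
      by (intro bexI[of _ "\<phi> (- c)"]) (simp_all add: carrier add zero)
  qed (auto simp: carrier add zero ac_simps)
  have mod: "module class_ring H"
  proof (rule Module.module.intro)
    show "cring (class_ring :: 'k ring)" by (rule class_cring.cring_axioms)
    show "module_axioms class_ring H"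
      by unfold_locales (auto simp: carrier add smult algebra_simps)
  qed (rule grp)
  interpret vectorspace "class_ring :: 'k ring" H
    by (rule vectorspace.intro[OF mod class_field.field_axioms])
  have lincomb: "lincomb a {\<phi> 1} = \<phi> (a (\<phi> 1))" for a
    unfolding lincomb_def by (subst finsum_insert) (auto simp: carrier smult add zero)
  have span: "span {\<phi> 1} = carrier H"
  proof -
    have "span {\<phi> 1} = {\<phi> (a (\<phi> 1)) | a. True}"
      by (subst finite_span) (auto simp: carrier lincomb)
    also have "\<dots> = range \<phi>" by (auto intro: exI[of _ "\<lambda>_. c" for c])
    finally show ?thesis by (simp add: carrier)
  qed
  have "basis {\<phi> 1}"
    unfolding basis_def
  proof (intro conjI)
    show "lin_indpt {\<phi> 1}"
    proof (rule finite_lin_indpt2)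
      fix a assume "lincomb a {\<phi> 1} = \<zero>\<^bsub>H\<^esub>"
      then have "a (\<phi> 1) = 0" using inj by (simp add: lincomb zero inj_eq)
      then show "\<forall>v\<in>{\<phi> 1}. a v = \<zero>\<^bsub>class_ring\<^esub>" by simp
    qed (auto simp: carrier)
  qed (use span carrier in auto)
  then have "dim = 1" using dim_basis[of "{\<phi> 1}"] by simp
  then show ?thesis using span vectorspace_axioms by simp
qed

section \<open>The complex in degrees zero to two and its first cohomology\<close>

context conj_stable
begin

definition one_form :: "('a \<Rightarrow> 'a \<Rightarrow> 'k::field) \<Rightarrow> ('a \<Rightarrow> 'a list \<Rightarrow> 'k) set" where
  "one_form f = Omega_class G C (form1 G C f)"

text \<open>The component \<open>R_a(h) - h\<close> of the differential of \<open>h\<close>; see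
  \<open>ext_d_form0\<close>.\<close>

definition diff_fun :: "('a \<Rightarrow> 'k::field) \<Rightarrow> 'a \<Rightarrow> 'a \<Rightarrow> 'k" where
  "diff_fun h a g = h (g \<otimes> a) - h g"

lemma ideal_quad_ideal: "ideal (quad_ideal G C :: ('a \<Rightarrow> 'a list \<Rightarrow> 'k::field) set) (cross_alg G C)"
proof -
  have "tens G (\<lambda>_. 1) ` ker_id_minus_braiding G C \<subseteq> carrier (cross_alg G C :: ('a \<Rightarrow> 'a list \<Rightarrow> 'k) ring)"
    using kernel_subset_quad_bound by (auto simp: quad_bound_def)
  then show ?thesis unfolding quad_ideal_def
    by (rule ring.genideal_ideal[OF ring_cross_alg[OF is_group C_carrier]])
qed

lemma Omega_class_hom:
  "Omega_class G C \<in> Ring.ring_hom (cross_alg G C :: ('a \<Rightarrow> 'a list \<Rightarrow> 'k::field) ring) (Omega G C)"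
  using ideal.rcos_ring_hom[OF ideal_quad_ideal] unfolding Omega_class_def[abs_def] Omega_def .

lemmas Omega_class_simps =
  Ring.ring_hom_mult[OF Omega_class_hom, symmetric] Ring.ring_hom_add[OF Omega_class_hom, symmetric]

lemma ring_Omega: "ring (Omega G C :: ('a \<Rightarrow> 'a list \<Rightarrow> 'k::field) set ring)"
  unfolding Omega_def by (rule ideal.quotient_is_ring[OF ideal_quad_ideal])

lemma Omega_class_eq_zero_iff:
  assumes "x \<in> carrier (cross_alg G C)"
  shows "Omega_class G C x = \<zero>\<^bsub>Omega G C\<^esub> \<longleftrightarrow> x \<in> quad_ideal G C"
proof -
  interpret ideal "quad_ideal G C" "cross_alg G C" by (rule ideal_quad_ideal)
  have "\<zero>\<^bsub>Omega G C\<^esub> = quad_ideal G C" by (simp add: Omega_def FactRing_def)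
  then show ?thesis unfolding Omega_class_def
    using a_rcos_self[OF assms] a_coset_join2[OF assms a_subgroup] by auto
qed

lemma one_form_carrier: "one_form f \<in> carrier (Omega G C)"
  unfolding one_form_def by (rule Ring.ring_hom_closed[OF Omega_class_hom form_carrier(2)])

text \<open>All relations start in degree 2, so the quotient does not identify distinct
  1-forms.\<close>

lemma one_form_eq_iff:
  "one_form f = one_form f' \<longleftrightarrow> (\<forall>g\<in>carrier G. \<forall>a\<in>C. f a g = f' a g)"
proof
  interpret ideal "quad_ideal G C" "cross_alg G C" by (rule ideal_quad_ideal)
  assume "one_form f = one_form f'"
  then have "form1 G C f \<in> quad_ideal G C +>\<^bsub>cross_alg G C\<^esub> form1 G C f'"
    using a_rcos_self[OF form_carrier(2)[of f]] by (simp add: one_form_def Omega_class_def)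
  then obtain x where x: "x \<in> quad_ideal G C" "form1 G C f = x \<oplus>\<^bsub>cross_alg G C\<^esub> form1 G C f'"
    by (auto simp: a_r_coset_def')
  have "x \<in> quad_bound" using x(1) quad_ideal_subset_quad_bound by blast
  then have x0: "x g [a] = 0" for g a by (simp add: quad_bound_def)
  have "form1 G C f g [a] = form1 G C f' g [a]" for g a
    unfolding x(2) by (simp add: cross_alg_def x0)
  from this[unfolded form1_def] show "\<forall>g\<in>carrier G. \<forall>a\<in>C. f a g = f' a g"
    by (simp split: if_splits) metis
next
  assume "\<forall>g\<in>carrier G. \<forall>a\<in>C. f a g = f' a g"
  then have "form1 G C f = form1 G C f'" by (auto simp: form1_def fun_eq_iff split: list.splits)
  then show "one_form f = one_form f'" by (simp add: one_form_def)
qed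

lemma one_form_add:
  "one_form f \<oplus>\<^bsub>Omega G C\<^esub> one_form f' = one_form (\<lambda>a g. f a g + f' a g)"
  by (simp add: one_form_def Omega_class_simps form_carrier form_add)

lemma one_form_smult:
  "c \<odot>\<^bsub>Omega_module G C\<^esub> one_form f = one_form (\<lambda>a g. c * f a g)"
  using form0_mult_form1[of "\<lambda>_. c" f]
  by (simp add: one_form_def Omega_module_def ring.defs Omega_class_simps form_carrier flip: form0_def)

lemma theta_eq: "theta G C = one_form (\<lambda>_ _. 1 :: 'k::field)"
proof -
  interpret O: ring "Omega G C :: ('a \<Rightarrow> 'a list \<Rightarrow> 'k) set ring" by (rule ring_Omega)
  have single: "tens G (\<lambda>_. 1) (word_basis [a]) = form1 G C (\<lambda>b g. if b = a then 1 else 0)"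
    if "a \<in> C" for a
    using that by (auto simp: tens_def word_basis_def form1_def fun_eq_iff split: list.splits)
  have "(\<Oplus>\<^bsub>Omega G C\<^esub>a\<in>S. Omega_class G C (tens G (\<lambda>_. 1) (word_basis [a])))
      = one_form (\<lambda>a g. if a \<in> S then 1 else 0 :: 'k)" if "finite S" "S \<subseteq> C" for S
    using that
  proof (induction S rule: finite_induct)
    case empty
    have "one_form (\<lambda>a g. 0 :: 'k) = \<zero>\<^bsub>Omega G C\<^esub>"
      using one_form_add[of "\<lambda>a g. 0 :: 'k" "\<lambda>a g. 0"] one_form_carrier[of "\<lambda>a g. 0 :: 'k"] by simp
    then show ?case by simp
  next
    case (insert a S)
    have "(\<Oplus>\<^bsub>Omega G C\<^esub>a\<in>insert a S. Omega_class G C (tens G (\<lambda>_. 1) (word_basis [a])))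
      = Omega_class G C (tens G (\<lambda>_. 1) (word_basis [a])) \<oplus>\<^bsub>Omega G C\<^esub>
        one_form (\<lambda>a g. if a \<in> S then 1 else 0 :: 'k)"
      using insert by (subst O.finsum_insert)
        (auto simp: single Pi_iff subset_iff one_form_carrier simp flip: one_form_def)
    also have "\<dots> = one_form (\<lambda>b g. (if b = a then 1 else 0) + (if b \<in> S then 1 else 0))"
      using insert.prems by (simp add: single one_form_add flip: one_form_def)
    also have "\<dots> = one_form (\<lambda>b g. if b \<in> insert a S then 1 else 0)"
      using insert.hyps by (intro arg_cong[of _ _ one_form] ext) auto
    finally show ?case .
  qed
  from this[OF finite_C] show ?thesis by (simp add: theta_def one_form_eq_iff)
qed

lemma Omega_deg_0:
  "(Omega_deg G C 0 :: ('a \<Rightarrow> 'a list \<Rightarrow> 'k::field) set set) = range (\<lambda>h. Omega_class G C (form0 G h))"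
proof -
  have "{x \<in> carrier (cross_alg G C). \<forall>g w. x g w \<noteq> 0 \<longrightarrow> length w = 0}
      = range (form0 G :: ('a \<Rightarrow> 'k) \<Rightarrow> _)"
    using homogeneous0 form0_nonzero form_carrier(1) by (fastforce simp: image_iff)
  then show ?thesis unfolding Omega_deg_def by (simp only: image_image)
qed

lemma Omega_deg_1:
  "(Omega_deg G C 1 :: ('a \<Rightarrow> 'a list \<Rightarrow> 'k::field) set set) = range one_form"
proof -
  have "{x \<in> carrier (cross_alg G C). \<forall>g w. x g w \<noteq> 0 \<longrightarrow> length w = 1}
      = range (form1 G C :: ('a \<Rightarrow> 'a \<Rightarrow> 'k) \<Rightarrow> _)"
    using homogeneous1 form1_nonzero form_carrier(2) by (fastforce simp: image_iff)
  then show ?thesis unfolding Omega_deg_def one_form_def by (simp only: image_image)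
qed

lemma ext_d_form0:
  fixes h :: "'a \<Rightarrow> 'k::field"
  shows "ext_d G C 0 (Omega_class G C (form0 G h)) = one_form (diff_fun h)"
proof -
  interpret O: ring "Omega G C :: ('a \<Rightarrow> 'a list \<Rightarrow> 'k) set ring" by (rule ring_Omega)
  have "ext_d G C 0 (Omega_class G C (form0 G h))
      = one_form (\<lambda>a g. h (g \<otimes> a)) \<ominus>\<^bsub>Omega G C\<^esub> one_form (\<lambda>a g. h g)"
    using form1_mult_form0[of "\<lambda>_ _. 1" h] form0_mult_form1[of h "\<lambda>_ _. 1"]
      one_form_carrier[of "\<lambda>a g. h g"]
    by (simp add: ext_d_def theta_eq one_form_def Omega_class_simps form_carrier)
  \<comment> \<open>\<open>R_a(h)\<close> is written as the difference plus \<open>h\<close>, so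
    that the subtracted form cancels.\<close>
  also have "\<dots> = one_form (diff_fun h) \<oplus>\<^bsub>Omega G C\<^esub> one_form (\<lambda>a g. h g)
      \<ominus>\<^bsub>Omega G C\<^esub> one_form (\<lambda>a g. h g)"
    by (simp add: one_form_add diff_fun_def)
  also have "\<dots> = one_form (diff_fun h)"
    by (simp add: O.minus_eq O.a_assoc O.r_neg one_form_carrier)
  finally show ?thesis .
qed

text \<open>The sign in degree 1 turns the graded commutator into an anticommutator. Multiplying by
  \<theta> on the left shifts \<open>f b\<close> to \<open>g \<otimes> a\<close>; on the right it
  leaves \<open>f a\<close> at \<open>g\<close>.\<close>

lemma ext_d_one_form:
  fixes f :: "'a \<Rightarrow> 'a \<Rightarrow> 'k::field"
  shows "ext_d G C 1 (one_form f) = Omega_class G C (form2 G C (\<lambda>a b g. f b (g \<otimes> a) + f a g))"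
proof -
  interpret O: ring "Omega G C :: ('a \<Rightarrow> 'a list \<Rightarrow> 'k) set ring" by (rule ring_Omega)
  let ?x = "theta G C \<otimes>\<^bsub>Omega G C\<^esub> one_form f" and ?y = "one_form f \<otimes>\<^bsub>Omega G C\<^esub> theta G C"
  have c: "?x \<in> carrier (Omega G C)" "?y \<in> carrier (Omega G C)"
    by (simp_all add: theta_eq one_form_carrier)
  then have "ext_d G C 1 (one_form f) = ?x \<oplus>\<^bsub>Omega G C\<^esub> ?y"
    unfolding ext_d_def by (simp add: O.minus_eq O.l_minus One_nat_def)
  also have "\<dots> = Omega_class G C (form2 G C (\<lambda>a b g. f b (g \<otimes> a) + f a g))"
    by (simp add: theta_eq one_form_def Omega_class_simps form_carrier form1_mult_form1 form_add)
  finally show ?thesis .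
qed

text \<open>The differential lies in \<open>quad_ideal\<close>, hence in \<open>quad_bound\<close>,
  whose degree-2 condition is this identity.\<close>

lemma one_form_cocycle_imp_flat:
  assumes "one_form f \<in> cocycles G C 1" "g \<in> carrier G" "a \<in> C" "b \<in> C"
  shows "f a g + f b (g \<otimes> a) = f (a \<otimes> b \<otimes> inv a) g + f a (g \<otimes> (a \<otimes> b \<otimes> inv a))"
proof -
  let ?x = "form2 G C (\<lambda>a b g. f b (g \<otimes> a) + f a g)"
  have "?x \<in> quad_ideal G C"
    using assms(1) by (simp add: cocycles_def ext_d_one_form Omega_class_eq_zero_iff form_carrier)
  then have "?x g [a \<otimes> b \<otimes> inv a, a] = ?x g [a, b]"
    using quad_ideal_subset_quad_bound assms by (auto simp: quad_bound_def)
  then show ?thesis using assms conj_C by (simp add: form2_def add.commute)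
qed

text \<open>The differential has the constant coefficient \<open>c + c\<close>.\<close>

lemma const_one_form_cocycle: "one_form (\<lambda>_ _. c) \<in> cocycles G C 1"
  using const_form2_in_quad_ideal[of "c + c"]
  by (simp add: cocycles_def Omega_deg_1 ext_d_one_form Omega_class_eq_zero_iff form_carrier)

lemma coboundaries_1: "coboundaries G C 1 = range (\<lambda>h. one_form (diff_fun h))"
  by (simp add: coboundaries_def One_nat_def Omega_deg_0 image_image ext_d_form0)

text \<open>By \<open>exact\<close>, each closed 1-form is cohomologous to a multiple of \<theta>.
  Involutivity separates the classes of different multiples.\<close>

theorem deRham_H1_one_dimensional:
  assumes "C \<noteq> {}" and involution: "\<And>a. a \<in> C \<Longrightarrow> a \<otimes> a = \<one>"
    and exact: "\<And>f :: 'a \<Rightarrow> 'a \<Rightarrow> 'k::field_char_0. one_form f \<in> cocycles G C 1 \<Longrightarrow>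
      \<exists>c h. \<forall>g\<in>carrier G. \<forall>a\<in>C. f a g = c + diff_fun h a g"
  defines "H \<equiv> deRham_H G C 1 :: ('k, ('a \<Rightarrow> 'a list \<Rightarrow> 'k) set set) module"
  shows "vectorspace class_ring H \<and> vectorspace.dim class_ring H = 1
    \<and> LinearCombinations.module.span class_ring H {deRham_class G C 1 (theta G C)} = carrier H"
proof -
  let ?B = "coboundaries G C 1 :: ('a \<Rightarrow> 'a list \<Rightarrow> 'k) set set"
  let ?O = "Omega G C :: ('a \<Rightarrow> 'a list \<Rightarrow> 'k) set ring"
  \<comment> \<open>\<open>\<phi> c\<close> is the class of \<open>c\<close> times \<theta>, with
    all its representatives listed.\<close>
  define \<phi> :: "'k \<Rightarrow> ('a \<Rightarrow> 'a list \<Rightarrow> 'k) set set" where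
    "\<phi> c = range (\<lambda>h. one_form (\<lambda>a g. c + diff_fun h a g))" for c
  have coset: "?B +>\<^bsub>?O\<^esub> one_form (\<lambda>a g. c + diff_fun h a g) = \<phi> c" for c and h :: "'a \<Rightarrow> 'k"
  proof -
    have eq: "one_form (diff_fun h') \<oplus>\<^bsub>?O\<^esub> one_form (\<lambda>a g. c + diff_fun h a g)
        = one_form (\<lambda>a g. c + diff_fun (\<lambda>g. h g + h' g) a g)" for h'
      unfolding one_form_add by (simp add: diff_fun_def algebra_simps)
    have "?B +>\<^bsub>?O\<^esub> one_form (\<lambda>a g. c + diff_fun h a g)
        = range (\<lambda>h'. one_form (\<lambda>a g. c + diff_fun (\<lambda>g. h g + h' g) a g))"
      by (auto simp: a_r_coset_def' coboundaries_1 eq)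
    also have "\<dots> = (\<lambda>h. one_form (\<lambda>a g. c + diff_fun h a g)) ` range (\<lambda>h' g. h g + h' g)"
      by (simp add: image_image)
    \<comment> \<open>Adding \<open>h\<close> is a bijection on functions, so the coset does not
      depend on \<open>h\<close>.\<close>
    also have "range (\<lambda>h' g. h g + h' g) = UNIV"
      by (rule surjI[of _ "\<lambda>h'' g. h'' g - h g"]) simp
    finally show ?thesis by (simp add: \<phi>_def)
  qed
  have coset_const: "?B +>\<^bsub>?O\<^esub> one_form (\<lambda>_ _. c) = \<phi> c" for c
    using coset[of c "\<lambda>_. 0"] by (simp add: diff_fun_def)
  have "inj \<phi>"
  proof (rule injI)
    fix c d assume "\<phi> c = \<phi> d"
    then have "one_form (\<lambda>a g. c + diff_fun (\<lambda>_. 0) a g) \<in> \<phi> d" by (auto simp: \<phi>_def)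
    then obtain h where h: "one_form (\<lambda>a g. c) = one_form (\<lambda>a g. d + diff_fun h a g)"
      by (auto simp: \<phi>_def diff_fun_def)
    obtain a where a: "a \<in> C" using \<open>C \<noteq> {}\<close> by blast
    \<comment> \<open>Along the loop from \<one> through \<open>a\<close> back to \<one> the two
      contributions of \<open>h\<close> add up to zero.\<close>
    have "c = d + diff_fun h a \<one>" "c = d + diff_fun h a a"
      using h a by (simp_all add: one_form_eq_iff)
    then have "2 * c = 2 * d" using involution[OF a] a by (simp add: diff_fun_def)
    then show "c = d" by simp
  qed
  moreover have "carrier H = range \<phi>"
  proof -
    have "carrier H = (\<lambda>z. ?B +>\<^bsub>?O\<^esub> z) ` cocycles G C 1"
      by (auto simp: H_def deRham_H_def quot_module_def A_RCOSETS_def' a_r_coset_def'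
        Omega_module_def ring.defs)
    moreover have "?B +>\<^bsub>?O\<^esub> z \<in> range \<phi>" if z: "z \<in> cocycles G C 1" for z
    proof -
      have "z \<in> Omega_deg G C 1" using z by (simp add: cocycles_def)
      then obtain f where f: "z = one_form f" by (auto simp: Omega_deg_1)
      then obtain c h where "\<forall>g\<in>carrier G. \<forall>a\<in>C. f a g = c + diff_fun h a g"
        using exact z by blast
      then have "z = one_form (\<lambda>a g. c + diff_fun h a g)" unfolding f one_form_eq_iff .
      then show ?thesis using coset by simp
    qed
    moreover have "\<phi> c \<in> (\<lambda>z. ?B +>\<^bsub>?O\<^esub> z) ` cocycles G C 1" for c
      by (rule image_eqI[OF _ const_one_form_cocycle[of c]]) (simp add: coset_const)
    ultimately show ?thesis by auto
  qed
  moreover have "\<zero>\<^bsub>H\<^esub> = \<phi> 0"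
    by (simp add: H_def deRham_H_def quot_module_def coboundaries_1 \<phi>_def)
  moreover have "\<phi> c \<oplus>\<^bsub>H\<^esub> \<phi> d = \<phi> (c + d)" for c d
  proof -
    have eq: "one_form (\<lambda>a g. c + diff_fun h a g) \<oplus>\<^bsub>?O\<^esub> one_form (\<lambda>a g. d + diff_fun h' a g)
        = one_form (\<lambda>a g. (c + d) + diff_fun (\<lambda>g. h g + h' g) a g)" for h h'
      unfolding one_form_add by (simp add: diff_fun_def algebra_simps)
    have "\<phi> c \<oplus>\<^bsub>H\<^esub> \<phi> d = \<phi> c <+>\<^bsub>?O\<^esub> \<phi> d"
      by (simp add: H_def deRham_H_def quot_module_def set_add_def' Omega_module_def ring.defs)
    also have "\<dots> = \<phi> (c + d)"
    proof
      show "\<phi> c <+>\<^bsub>?O\<^esub> \<phi> d \<subseteq> \<phi> (c + d)" by (auto simp: set_add_def' \<phi>_def eq)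
      have "one_form (\<lambda>a g. (c + d) + diff_fun h a g) \<in> \<phi> c <+>\<^bsub>?O\<^esub> \<phi> d" for h
        using eq[of h "\<lambda>_. 0"] by (force simp: set_add_def' \<phi>_def)
      then show "\<phi> (c + d) \<subseteq> \<phi> c <+>\<^bsub>?O\<^esub> \<phi> d" unfolding \<phi>_def[of "c + d"] by auto
    qed
    finally show ?thesis .
  qed
  moreover have "c \<odot>\<^bsub>H\<^esub> \<phi> d = \<phi> (c * d)" for c d
  proof -
    have eq: "c \<odot>\<^bsub>Omega_module G C\<^esub> one_form (\<lambda>a g. d + diff_fun h a g)
        = one_form (\<lambda>a g. c * d + diff_fun (\<lambda>g. c * h g) a g)" for h
      unfolding one_form_smult by (simp add: diff_fun_def algebra_simps)
    have "c \<odot>\<^bsub>H\<^esub> \<phi> d = (\<Union>x\<in>\<phi> d. ?B +>\<^bsub>?O\<^esub> (c \<odot>\<^bsub>Omega_module G C\<^esub> x))"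
      by (simp add: H_def deRham_H_def quot_module_def a_r_coset_def' Omega_module_def ring.defs)
    also have "\<dots> = (\<Union>h. ?B +>\<^bsub>?O\<^esub> one_form (\<lambda>a g. c * d + diff_fun (\<lambda>g. c * h g) a g))"
      by (simp add: \<phi>_def[of d] eq)
    \<comment> \<open>Each member of the union is already the whole coset, also for
      \<open>c = 0\<close>.\<close>
    also have "\<dots> = \<phi> (c * d)" by (simp add: coset)
    finally show ?thesis .
  qed
  moreover have "deRham_class G C 1 (theta G C) = \<phi> 1"
    by (simp add: deRham_class_def theta_eq coset_const)
  ultimately show ?thesis using one_dimensional_vectorspace[of \<phi> H] by simp
qed

end

section \<open>Specialisation to the 2-cycles of the symmetric group\<close>

theorem proposition3p3:
  fixes N :: nat
  assumes "2 \<le> N" and "N < 6"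
  shows "let G = sym_group N; C = two_cycles N;
             \<theta> = theta G C;
             H = (deRham_H G C 1 :: ('k::field_char_0, ((nat \<Rightarrow> nat) \<Rightarrow> (nat \<Rightarrow> nat) list \<Rightarrow> 'k) set set) module)
         in \<theta> \<in> cocycles G C 1 \<and>
            vectorspace class_ring H \<and>
            vectorspace.dim class_ring H = 1 \<and>
            LinearCombinations.module.span class_ring H {deRham_class G C 1 \<theta>} = carrier H"
proof -
  let ?G = "sym_group N" and ?C = "two_cycles N"
  have group: "group ?G" by (rule sym_group_is_group)
  have closed: "?C \<subseteq> carrier ?G" using two_cycles_permutes by (auto simp: sym_group_carrier)
  \<comment> \<open>This turns the conjugate in the braiding into
    \<open>a \<circ> b \<circ> a\<close>, the form used for flat weights.\<close>
  have inv: "inv\<^bsub>?G\<^esub> a = a" if "a \<in> ?C" for a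
    using that closed two_cycles_involution[OF that]
    by (intro group.inv_equality[OF group]) (auto simp: sym_group_mult sym_group_one)
  interpret conj_stable ?G ?C
  proof (rule conj_stable.intro[OF group], unfold_locales)
    have "finite {p. p permutes {1..N}}" by (rule finite_permutations) simp
    then show "finite ?C" by (rule rev_finite_subset) (auto dest: two_cycles_permutes)
    show "a \<otimes>\<^bsub>?G\<^esub> b \<otimes>\<^bsub>?G\<^esub> inv\<^bsub>?G\<^esub> a \<in> ?C" if "a \<in> ?C" "b \<in> ?C" for a b
      using two_cycles_conj[OF two_cycles_permutes two_cycles_involution] that
      by (simp add: inv sym_group_mult)
  qed (rule closed)
  \<comment> \<open>Here \<open>2 \<le> N\<close> enters: it supplies the loop that shows the class
    of \<theta> to be nonzero.\<close>
  have "transpose 1 2 \<in> ?C"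
    unfolding two_cycles_def using assms(1) by (intro CollectI exI[of _ 1] exI[of _ 2]) simp
  then have nonempty: "?C \<noteq> {}" by blast
  have exact: "\<exists>c h. \<forall>g\<in>carrier ?G. \<forall>a\<in>?C. f a g = c + diff_fun h a g"
    if f: "one_form f \<in> cocycles ?G ?C 1" for f :: "(nat \<Rightarrow> nat) \<Rightarrow> (nat \<Rightarrow> nat) \<Rightarrow> 'k"
  proof -
    have "flat_weight N f"
    proof
      fix g a b assume "g permutes {1..N}" "a \<in> ?C" "b \<in> ?C"
      then show "f a g + f b (g \<circ> a) = f (a \<circ> b \<circ> a) g + f a (g \<circ> (a \<circ> b \<circ> a))"
        using one_form_cocycle_imp_flat[OF f, of g a b]
        by (simp add: inv sym_group_carrier sym_group_mult)
    qed
    from flat_weight.flat_imp_const_plus_exact[OF this] show ?thesis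
      by (simp add: diff_fun_def sym_group_carrier sym_group_mult Ball_def)
  qed
  have involution: "a \<otimes>\<^bsub>?G\<^esub> a = \<one>\<^bsub>?G\<^esub>" if "a \<in> ?C" for a
    using two_cycles_involution[OF that] by (simp only: sym_group_mult sym_group_one)
  have "theta ?G ?C \<in> (cocycles ?G ?C 1 :: ((nat \<Rightarrow> nat) \<Rightarrow> (nat \<Rightarrow> nat) list \<Rightarrow> 'k) set set)"
    unfolding theta_eq by (rule const_one_form_cocycle)
  with deRham_H1_one_dimensional[OF nonempty involution exact] show ?thesis
    unfolding Let_def by blast
qed

end
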